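(* Let $c\geq 2$ be an odd integer and let $0\leq a<c$ be an integer. Then for all sufficiently large $n_1$ and $n_2$ with $n_1<n_2+1$, \[ \overline{N}_2(a,c,n_1)\,\overline{N}_2(a,c,n_2)>\overline{N}_2(a,c,n_1-1)\,\overline{N}_2(a,c,n_2+1). \]
   Context: An overpartition of a nonnegative integer $n$ is a partition of $n$ in which the first occurrence of each distinct part may be overlined. For an overpartition $\lambda$, let $l(\lambda)$ be its largest part, $n(\lambda)$ its number of parts, and $n(\lambda_o)$ its number of odd non-overlined parts; let $\chi(\lambda)=1$ if $l(\lambda)$ is odd and non-overlined, and $\chi(\lambda)=0$ otherwise. The $M_2$-rank of $\lambda$ is $\lceil l(\lambda)/2\rceil-n(\lambda)-n(\lambda_o)-\chi(\lambda)$. $\overline{N}_2(a,c,n)$ denotes the number of overpartitions of $n$ whose $M_2$-rank is congruent to $a$ modulo $c$. *)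

theory Defs
  imports "HOL-Library.Multiset" "HOL-Number_Theory.Cong" Complex_Main
begin

text \<open>
  An overpartition is a pair \<open>(M, S)\<close>: the multiset \<open>M\<close> of all its parts and the set \<open>S\<close> of
  those part sizes whose first occurrence is overlined.
\<close>

type_synonym overpart = "nat multiset \<times> nat set"

definition overpartition_of :: "nat \<Rightarrow> overpart \<Rightarrow> bool" where
  "overpartition_of n p \<longleftrightarrow>
     0 \<notin># fst p \<and> \<Sum>\<^sub># (fst p) = n \<and> snd p \<subseteq> set_mset (fst p)"

definition largest_part :: "overpart \<Rightarrow> nat" where
  "largest_part p = (if fst p = {#} then 0 else Max (set_mset (fst p)))"

definition num_parts :: "overpart \<Rightarrow> nat" where
  "num_parts p = size (fst p)"

definition non_overlined :: "overpart \<Rightarrow> nat multiset" where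
  "non_overlined p = fst p - mset_set (snd p)"

definition num_odd_non_overlined :: "overpart \<Rightarrow> nat" where
  "num_odd_non_overlined p = size (filter_mset odd (non_overlined p))"

text \<open>
  The largest part is the first occurrence of the largest size. So it counts as overlined as soon
  as that size lies in \<open>S\<close>, even if further non-overlined copies are present.
\<close>

definition overpart_chi :: "overpart \<Rightarrow> nat" where
  "overpart_chi p = (if odd (largest_part p) \<and> largest_part p \<notin> snd p then 1 else 0)"

definition M2_rank :: "overpart \<Rightarrow> int" where
  "M2_rank p = \<lceil>real (largest_part p) / 2\<rceil> - int (num_parts p)
     - int (num_odd_non_overlined p) - int (overpart_chi p)"

definition N2bar :: "int \<Rightarrow> int \<Rightarrow> nat \<Rightarrow> nat" where
  "N2bar a c n = card {p. overpartition_of n p \<and> [M2_rank p = a] (mod c)}"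

text \<open>The sets counted by \<open>N2bar\<close> are finite, so \<open>card\<close> is the genuine count.\<close>

lemma finite_overpartitions: "finite {p. overpartition_of n p}"
proof (rule finite_subset)
  let ?B = "mset ` {xs. set xs \<subseteq> {..n} \<and> length xs \<le> n} \<times> Pow {..n}"
  show "finite ?B"
    by (intro finite_cartesian_product finite_imageI finite_lists_length_le) auto
  have size_le: "size M \<le> \<Sum>\<^sub># M" if "0 \<notin># M" for M :: "nat multiset"
    using that by (induction M) auto
  show "{p. overpartition_of n p} \<subseteq> ?B"
  proof
    fix p :: overpart
    assume "p \<in> {p. overpartition_of n p}"
    then obtain M S where l: "p = (M, S)" and M: "0 \<notin># M" "\<Sum>\<^sub># M = n" "S \<subseteq> set_mset M"
      by (cases p) (auto simp: overpartition_of_def)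
    obtain xs where xs: "M = mset xs"
      using ex_mset by metis
    have sub: "set_mset M \<subseteq> {..n}"
      using M(2) sum_mset.remove by fastforce
    have "length xs \<le> n"
      using size_le[OF M(1)] M(2) xs by simp
    then show "p \<in> ?B"
      using sub M(3) unfolding l xs by auto
  qed
qed

end

theory Submission
  imports Defs "HOL-Probability.Probability" "HOL-Real_Asymp.Real_Asymp"
begin

text \<open>
  Let \<open>P(q) = \<Prod>\<^bsub>j\<ge>1\<^esub> (1 + q\<^sup>j) / (1 - q\<^sup>j)\<close> be the generating function of all overpartitions. It suffices to find,
  for every large \<open>n\<close>, some \<open>r\<close> for which \<open>N(n) r\<^sup>n\<close> exceeds the mean of its two neighbours: by the AM-GM
  inequality this yields \<open>N(n - 1) N(n + 1) < N(n)\<^sup>2\<close>, that is, the ratios of consecutive values decrease.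

  Replacing \<open>N(n)\<close> by \<open>1 / c\<close> times the number of all overpartitions of \<open>n\<close> costs little. For a \<open>c\<close>-th root
  of unity \<open>w \<noteq> 1\<close>, exchanging two non-overlined parts of even size \<open>s\<close> for one of size \<open>2 s\<close> changes the
  rank by one, so the sum of \<open>w\<close> to the rank cancels down to a geometric sum. Five such pairs of sizes
  gain a factor \<open>(1 - r)\<^sup>5\<close> over \<open>P(r)\<close>.

  For the full count, take \<open>r = exp (- x)\<close> at the saddle point, where \<open>P(r q) / P(r)\<close>, as a function on the
  unit circle, is the characteristic function of a law with mean \<open>n\<close> and variance \<open>\<sigma>\<^sup>2\<close> of order \<open>x\<^sup>-\<^sup>3\<close>.
  Since \<open>log P\<close> has nonnegative coefficients, it is close to a Gaussian near \<open>q = 1\<close> and small elsewhere, and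
  dominated convergence shows that the excess over the mean of the neighbours, divided by \<open>P(r)\<close>, is
  asymptotic to a positive multiple of \<open>\<sigma>\<^sup>-\<^sup>3\<close>. No modularity is needed.
\<close>

section \<open>Generating functions of restricted overpartitions\<close>

text \<open>The obstacle is precision. Comparing \<open>n\<close> with the mean of its neighbours
  puts 1 - cos \<phi> into the integral, so the excess is smaller than the term itself by a factor
  of order \<sigma>^2. An asymptotic formula for N(n) with relative error o(1) would not decide the
  inequality; the error of equidistribution has to be measured against the excess itself.

  That error needs no integral. The cancellation is recorded as a majorant with nonnegative
  coefficients, and a coefficient of such a series, times r^n, is at most the value at r. Further
  pairs of sizes would gain further factors 1 - r at the price of a constant. The exchange has its
  simple effect on the rank only while the largest part exceeds the sizes involved; all other
  overpartitions have parts in a fixed finite range and are counted separately.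

  The combinatorial half works with products truncated at an arbitrary N \<ge> n, so infinite
  products never occur as formal power series; P itself arises only as a limit of numerical
  functions.\<close>

definition mparts :: "nat set \<Rightarrow> nat \<Rightarrow> nat multiset set" where
  "mparts V n = {R. set_mset R \<subseteq> V \<and> \<Sum>\<^sub># R = n}"

definition sparts :: "nat set \<Rightarrow> nat \<Rightarrow> nat set set" where
  "sparts U n = {S. S \<subseteq> U \<and> \<Sum>S = n}"

lemma finite_mparts:
  assumes "0 \<notin> V"
  shows "finite (mparts V n)"
proof (rule finite_subset)
  show "mparts V n \<subseteq> fst ` {p. overpartition_of n p}"
    using assms by (force simp: mparts_def overpartition_of_def image_iff)
qed (intro finite_imageI finite_overpartitions)

lemma finite_sparts: "finite U \<Longrightarrow> finite (sparts U n)"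
  by (rule finite_subset[of _ "Pow U"]) (auto simp: sparts_def)

text \<open>Removing one copy of \<open>j\<close> leaves \<open>j\<close> available, so
  \<open>insert j V\<close> reappears on the right; this self-reference becomes the geometric factor
  \<open>inverse (1 - fps_const w * fps_X ^ j)\<close>. For sets a removed \<open>j\<close> is used
  up, whence the factor \<open>1 + fps_X ^ j\<close>.\<close>

lemma mparts_insert:
  assumes "j \<notin> V"
  shows "mparts (insert j V) n =
    mparts V n \<union> (if j \<le> n then add_mset j ` mparts (insert j V) (n - j) else {})"
proof (intro equalityI subsetI)
  fix R assume R: "R \<in> mparts (insert j V) n"
  show "R \<in> mparts V n \<union> (if j \<le> n then add_mset j ` mparts (insert j V) (n - j) else {})"
  proof (cases "j \<in># R")
    case True
    then obtain R' where "R = add_mset j R'"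
      by (meson multi_member_split)
    then show ?thesis
      using R by (auto simp: mparts_def)
  qed (use R in \<open>auto simp: mparts_def\<close>)
qed (auto simp: mparts_def split: if_splits)

lemma sparts_insert:
  assumes "j \<notin> U" "finite U"
  shows "sparts (insert j U) n =
    sparts U n \<union> (if j \<le> n then insert j ` sparts U (n - j) else {})"
proof (intro equalityI subsetI)
  fix S assume S: "S \<in> sparts (insert j U) n"
  then have fin: "finite S"
    using assms by (auto simp: sparts_def intro: finite_subset)
  show "S \<in> sparts U n \<union> (if j \<le> n then insert j ` sparts U (n - j) else {})"
  proof (cases "j \<in> S")
    case True
    then have eq: "S = insert j (S - {j})" by auto
    have "\<Sum>S = j + \<Sum>(S - {j})"
      using fin True by (subst eq, subst sum.insert) auto
    then have "S - {j} \<in> sparts U (n - j)" "j \<le> n"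
      using S by (auto simp: sparts_def)
    moreover have "S \<in> insert j ` sparts U (n - j)"
      using calculation(1) by (metis eq image_eqI)
    ultimately show ?thesis by simp
  qed (use S in \<open>auto simp: sparts_def\<close>)
next
  fix S assume S: "S \<in> sparts U n \<union> (if j \<le> n then insert j ` sparts U (n - j) else {})"
  have "\<Sum>(insert j T) = j + \<Sum>T" if "T \<subseteq> U" for T
    using that assms by (subst sum.insert) (auto intro: finite_subset)
  then show "S \<in> sparts (insert j U) n"
    using S by (auto simp: sparts_def split: if_splits)
qed

text \<open>The weight \<open>w ^ size R\<close> records the number of parts, the only ingredient of
  the rank that small even parts affect; \<open>w = 1\<close> gives the plain count.\<close>

lemma mparts_fps:
  fixes w :: "'a :: field"
  assumes "finite V" "0 \<notin> V"
  shows "Abs_fps (\<lambda>n. \<Sum>R\<in>mparts V n. w ^ size R) =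
           (\<Prod>j\<in>V. inverse (1 - fps_const w * fps_X ^ j))"
  using assms
proof (induction V rule: finite_induct)
  case empty
  have "mparts {} n = (if n = 0 then {{#}} else {})" for n
    by (auto simp: mparts_def)
  then show ?case by (intro fps_ext) auto
next
  case (insert j V)
  define G where "G V = Abs_fps (\<lambda>n. \<Sum>R\<in>mparts V n. w ^ size R)" for V
  have j: "j > 0" "0 \<notin> V" using insert by auto
  have rec: "G (insert j V) = G V + (fps_const w * fps_X ^ j) * G (insert j V)"
  proof (rule fps_ext)
    fix n
    have inj: "inj_on (add_mset j) A" for A by (auto simp: inj_on_def)
    have "fps_nth (G (insert j V)) n =
      (\<Sum>R\<in>mparts V n. w ^ size R) +
      (\<Sum>R\<in>(if j \<le> n then add_mset j ` mparts (insert j V) (n - j) else {}). w ^ size R)"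
      unfolding G_def fps_nth_Abs_fps
    proof (subst mparts_insert[OF insert.hyps(2)], rule sum.union_disjoint)
      show "finite (mparts V n)"
          "finite (if j \<le> n then add_mset j ` mparts (insert j V) (n - j) else {})"
        using j insert.prems by (simp_all add: finite_mparts)
      show "mparts V n \<inter> (if j \<le> n then add_mset j ` mparts (insert j V) (n - j) else {}) = {}"
      proof -
        have "R \<notin> add_mset j ` A" if "set_mset R \<subseteq> V" for R A
          using that insert.hyps(2) by auto
        then show ?thesis
          by (simp add: mparts_def disjoint_iff)
      qed
    qed
    also have "(\<Sum>R\<in>(if j \<le> n then add_mset j ` mparts (insert j V) (n - j) else {}). w ^ size R)
      = (if j \<le> n then w * fps_nth (G (insert j V)) (n - j) else 0)"
      by (auto simp: sum.reindex[OF inj] G_def sum_distrib_left)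
    finally show "fps_nth (G (insert j V)) n =
        fps_nth (G V + (fps_const w * fps_X ^ j) * G (insert j V)) n"
      by (simp add: G_def mult.assoc fps_X_power_mult_nth not_le)
  qed
  have "G (insert j V) * (1 - fps_const w * fps_X ^ j) =
      G (insert j V) - (fps_const w * fps_X ^ j) * G (insert j V)"
    by (simp add: algebra_simps)
  also have "\<dots> = G V"
    using rec by (metis add_diff_cancel_right')
  finally have 1: "G (insert j V) * (1 - fps_const w * fps_X ^ j) = G V" .
  have 2: "(1 - fps_const w * fps_X ^ j) * inverse (1 - fps_const w * fps_X ^ j) = 1"
    using j by (intro inverse_mult_eq_1') simp
  have "inverse (1 - fps_const w * fps_X ^ j) * G V =
      G (insert j V) * ((1 - fps_const w * fps_X ^ j) * inverse (1 - fps_const w * fps_X ^ j))"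
    unfolding 1[symmetric] by (simp only: mult_ac)
  then have "G (insert j V) = inverse (1 - fps_const w * fps_X ^ j) * G V"
    unfolding 2 by simp
  moreover have "G V = (\<Prod>j\<in>V. inverse (1 - fps_const w * fps_X ^ j))"
    unfolding G_def by (rule insert.IH[OF j(2)])
  ultimately show ?case
    unfolding G_def[symmetric] prod.insert[OF insert.hyps] by (simp only:)
qed

lemma sparts_fps:
  assumes "finite U"
  shows "Abs_fps (\<lambda>n. of_nat (card (sparts U n))) = (\<Prod>j\<in>U. 1 + fps_X ^ j :: 'a :: field fps)"
  using assms
proof (induction U rule: finite_induct)
  case empty
  have "sparts {} n = (if n = 0 then {{}} else {})" for n
    by (auto simp: sparts_def)
  then show ?case by (intro fps_ext) auto
next
  case (insert j U)
  have inj: "inj_on (insert j) (sparts U m)" for m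
    using insert by (intro inj_onI) (auto simp: sparts_def)
  have "card (sparts (insert j U) n) = card (sparts U n) +
      card (if j \<le> n then insert j ` sparts U (n - j) else {})" for n
    using insert by (subst sparts_insert)
      (auto intro!: card_Un_disjoint simp: finite_sparts sparts_def)
  then have "card (sparts (insert j U) n) = card (sparts U n) +
      (if j \<le> n then card (sparts U (n - j)) else 0)" for n
    by (simp add: card_image[OF inj])
  then have "Abs_fps (\<lambda>n. of_nat (card (sparts (insert j U) n))) =
      (1 + fps_X ^ j) * Abs_fps (\<lambda>n. of_nat (card (sparts U n)) :: 'a)"
    by (intro fps_ext) (auto simp: ring_distribs fps_X_power_mult_nth)
  then show ?case using insert by simp
qed

text \<open>
  From here on an overpartition is a pair \<open>(R, S)\<close> of the multiset \<open>R\<close> of its non-overlined parts and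
  the set \<open>S\<close> of its overlined parts; in \<open>overpart\<close> the first component is \<open>R + mset_set S\<close>.
\<close>

definition wt :: "nat multiset \<times> nat set \<Rightarrow> nat" where
  "wt p = \<Sum>\<^sub># (fst p) + \<Sum>(snd p)"

definition rparts :: "nat set \<Rightarrow> nat set \<Rightarrow> (nat multiset \<times> nat set) set" where
  "rparts V U = {p. set_mset (fst p) \<subseteq> V \<and> snd p \<subseteq> U}"

definition opset :: "nat set \<Rightarrow> nat set \<Rightarrow> nat \<Rightarrow> (nat multiset \<times> nat set) set" where
  "opset V U n = {p \<in> rparts V U. wt p = n}"

lemma opset_eq_image:
  "opset V U n = (\<lambda>(l, S, R). (R, S)) ` (SIGMA l:{..n}. sparts U l \<times> mparts V (n - l))"
proof (intro equalityI subsetI)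
  fix p assume "p \<in> opset V U n"
  then show "p \<in> (\<lambda>(l, S, R). (R, S)) ` (SIGMA l:{..n}. sparts U l \<times> mparts V (n - l))"
    by (cases p)
      (auto simp: opset_def rparts_def wt_def sparts_def mparts_def image_iff intro!: exI)
qed (auto simp: opset_def rparts_def wt_def sparts_def mparts_def)

lemma finite_opset: "finite U \<Longrightarrow> 0 \<notin> V \<Longrightarrow> finite (opset V U n)"
  unfolding opset_eq_image
  by (intro finite_imageI finite_SigmaI finite_cartesian_product finite_sparts finite_mparts) auto

lemma opset_fps:
  assumes "finite U" "finite V" "0 \<notin> V"
  shows "of_nat (card (opset V U n)) =
    fps_nth ((\<Prod>j\<in>U. 1 + fps_X ^ j) * (\<Prod>j\<in>V. inverse (1 - fps_X ^ j)) :: 'a :: field fps) n"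
proof -
  have "inj_on (\<lambda>(l, S, R). (R, S)) (SIGMA l:{..n}. sparts U l \<times> mparts V (n - l))"
    by (auto simp: inj_on_def sparts_def)
  then have "card (opset V U n) = (\<Sum>l\<le>n. card (sparts U l) * card (mparts V (n - l)))"
    unfolding opset_eq_image using assms
    by (subst card_image) (auto simp: finite_sparts finite_mparts card_cartesian_product)
  moreover have "(\<Prod>j\<in>V. inverse (1 - fps_X ^ j)) = Abs_fps (\<lambda>n. of_nat (card (mparts V n)) :: 'a)"
    using mparts_fps[OF assms(2,3), of "1 :: 'a"] by simp
  ultimately show ?thesis
    unfolding sparts_fps[OF assms(1), symmetric] by (simp add: fps_mult_nth atLeast0AtMost)
qed

text \<open>Non-overlined parts with sizes in \<open>T\<close> can be chosen independently of the
  rest. This is applied to all ten exchanged sizes and again to the smaller size of each pair, so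
  that a bound for the inner sums can be reassembled into a count. The condition
  \<open>wt p \<le> n\<close> keeps truncated subtraction from admitting the empty
  \<open>\<tau>\<close> for a \<open>p\<close> that is too large.\<close>

lemma bij_betw_opset_Un:
  assumes "V \<inter> T = {}" "finite U"
  shows "bij_betw (\<lambda>(p, \<tau>). (fst p + \<tau>, snd p))
    (SIGMA p:{p \<in> rparts V U. wt p \<le> n}. mparts T (n - wt p)) (opset (V \<union> T) U n)"
proof (rule bij_betw_byWitness[where f' = "\<lambda>p. ((filter_mset (\<lambda>j. j \<in> V) (fst p), snd p),
    filter_mset (\<lambda>j. j \<notin> V) (fst p))"])
  have dis: "x \<in> V \<Longrightarrow> x \<notin> T" for x using assms by auto
  have 1: "filter_mset (\<lambda>j. j \<in> V) (R + \<tau>) = R" "filter_mset (\<lambda>j. j \<notin> V) (R + \<tau>) = \<tau>"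
    if "set_mset R \<subseteq> V" "set_mset \<tau> \<subseteq> T" for R \<tau>
  proof -
    have "filter_mset (\<lambda>j. j \<in> V) R = R" "filter_mset (\<lambda>j. j \<notin> V) \<tau> = \<tau>"
      using that dis by (auto simp: filter_mset_eq_conv)
    moreover have "filter_mset (\<lambda>j. j \<in> V) \<tau> = {#}" "filter_mset (\<lambda>j. j \<notin> V) R = {#}"
      using that dis by (auto simp: multiset_eq_iff count_eq_zero_iff)
    ultimately show "filter_mset (\<lambda>j. j \<in> V) (R + \<tau>) = R"
        "filter_mset (\<lambda>j. j \<notin> V) (R + \<tau>) = \<tau>" by simp_all
  qed
  show "\<forall>a\<in>SIGMA p:{p \<in> rparts V U. wt p \<le> n}. mparts T (n - wt p).
      (\<lambda>p. ((filter_mset (\<lambda>j. j \<in> V) (fst p), snd p), filter_mset (\<lambda>j. j \<notin> V) (fst p)))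
        ((\<lambda>(p, \<tau>). (fst p + \<tau>, snd p)) a) = a"
    using 1 by (auto simp: rparts_def mparts_def simp del: filter_union_mset)
  show "\<forall>a'\<in>opset (V \<union> T) U n.
       (\<lambda>(p, \<tau>). (fst p + \<tau>, snd p))
        ((filter_mset (\<lambda>j. j \<in> V) (fst a'), snd a'), filter_mset (\<lambda>j. j \<notin> V) (fst a')) = a'"
    by (auto simp flip: multiset_partition)
  show "(\<lambda>(p, \<tau>). (fst p + \<tau>, snd p)) `
    (SIGMA p:{p \<in> rparts V U. wt p \<le> n}. mparts T (n - wt p)) \<subseteq> opset (V \<union> T) U n"
    by (auto simp: opset_def rparts_def mparts_def wt_def)
  show "(\<lambda>p. ((filter_mset (\<lambda>j. j \<in> V) (fst p), snd p), filter_mset (\<lambda>j. j \<notin> V) (fst p))) `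
    opset (V \<union> T) U n \<subseteq> (SIGMA p:{p \<in> rparts V U. wt p \<le> n}. mparts T (n - wt p))"
  proof (clarsimp simp: image_subset_iff)
    fix R S assume RS: "(R, S) \<in> opset (V \<union> T) U n"
    have "\<Sum>\<^sub># R = \<Sum>\<^sub># (filter_mset (\<lambda>j. j \<in> V) R) + \<Sum>\<^sub># (filter_mset (\<lambda>j. j \<notin> V) R)"
      by (metis multiset_partition sum_mset.union)
    then show "(filter_mset (\<lambda>j. j \<in> V) R, S) \<in> rparts V U \<and>
        wt (filter_mset (\<lambda>j. j \<in> V) R, S) \<le> n \<and>
        filter_mset (\<lambda>j. j \<notin> V) R \<in> mparts T (n - wt (filter_mset (\<lambda>j. j \<in> V) R, S))"
      using RS by (auto simp: opset_def rparts_def mparts_def wt_def)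
  qed
qed

text \<open>Every size in \<open>S\<close> occurs in the multiset of all parts, so one copy of each
  can be set aside as the overlined one. Any \<open>N \<ge> n\<close> bounds the sizes, which leaves
  \<open>N\<close> free to be large or to tend to infinity.\<close>

lemma bij_betw_overpartitions:
  assumes "n \<le> N"
  shows "bij_betw (\<lambda>(R, S). (R + mset_set S, S)) (opset {1..N} {1..N} n) {p. overpartition_of n p}"
proof (rule bij_betw_byWitness[where f' = "\<lambda>p. (fst p - mset_set (snd p), snd p)"])
  show "\<forall>a\<in>opset {1..N} {1..N} n.
       (fst ((\<lambda>(R, S). (R + mset_set S, S)) a) - mset_set (snd ((\<lambda>(R, S). (R + mset_set S, S)) a)),
        snd ((\<lambda>(R, S). (R + mset_set S, S)) a)) = a"
    by auto
  have sub: "mset_set S \<subseteq># M" if "S \<subseteq> set_mset M" for S :: "nat set" and M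
  proof -
    have "finite S" using that by (auto intro: finite_subset)
    then show ?thesis
      using that by (auto simp: subseteq_mset_def count_mset_set' count_greater_zero_iff Suc_le_eq)
  qed
  show "\<forall>a'\<in>{p. overpartition_of n p}.
       (\<lambda>(R, S). (R + mset_set S, S)) (fst a' - mset_set (snd a'), snd a') = a'"
    using sub by (auto simp: overpartition_of_def)
  have ms: "\<Sum>\<^sub># (mset_set S) = \<Sum>S" for S :: "nat set"
    by (simp add: sum_unfold_sum_mset)
  show "(\<lambda>(R, S). (R + mset_set S, S)) ` opset {1..N} {1..N} n \<subseteq> {p. overpartition_of n p}"
  proof (rule image_subsetI)
    fix p assume "p \<in> opset {1..N} {1..N} n"
    then obtain R S where p: "p = (R, S)" and *: "(R, S) \<in> opset {1..N} {1..N} n"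
      by (cases p) auto
    then have "finite S" by (auto simp: opset_def rparts_def intro: finite_subset)
    then show "(\<lambda>(R, S). (R + mset_set S, S)) p \<in> {p. overpartition_of n p}"
      using * p by (auto simp: opset_def rparts_def overpartition_of_def wt_def ms)
  qed
  show "(\<lambda>p. (fst p - mset_set (snd p), snd p)) ` {p. overpartition_of n p}
      \<subseteq> opset {1..N} {1..N} n"
  proof (rule image_subsetI)
    fix p assume "p \<in> {p. overpartition_of n p}"
    then obtain M S where p: "p = (M, S)" and *: "overpartition_of n (M, S)"
      by (cases p) auto
    have "x \<in> {1..N}" if "x \<in># M" for x
      using * that assms multi_member_split[OF that]
      by (cases x) (auto simp: overpartition_of_def)
    moreover have "\<Sum>\<^sub># M = \<Sum>\<^sub># (M - mset_set S) + \<Sum>\<^sub># (mset_set S)"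
      using * sub by (metis overpartition_of_def fst_conv snd_conv subset_mset.diff_add sum_mset.union)
    ultimately show "(fst p - mset_set (snd p), snd p) \<in> opset {1..N} {1..N} n"
      using * p by (auto simp: opset_def rparts_def overpartition_of_def wt_def ms dest: in_diffD)
  qed
qed

section \<open>Equidistribution of the rank\<close>

definition fps_maj :: "complex fps \<Rightarrow> real fps \<Rightarrow> bool" where
  "fps_maj f g \<longleftrightarrow> (\<forall>n. norm (fps_nth f n) \<le> fps_nth g n)"

lemma fps_maj_mult:
  assumes "fps_maj f1 g1" "fps_maj f2 g2"
  shows "fps_maj (f1 * f2) (g1 * g2)"
  unfolding fps_maj_def
proof
  fix n
  have "norm (fps_nth (f1 * f2) n) \<le> (\<Sum>i=0..n. norm (fps_nth f1 i) * norm (fps_nth f2 (n - i)))"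
    unfolding fps_mult_nth by (rule order_trans[OF norm_sum]) (simp add: norm_mult)
  also have "\<dots> \<le> (\<Sum>i=0..n. fps_nth g1 i * fps_nth g2 (n - i))"
    using assms unfolding fps_maj_def
    by (intro sum_mono mult_mono) (auto intro: order_trans[OF norm_ge_zero])
  finally show "norm (fps_nth (f1 * f2) n) \<le> fps_nth (g1 * g2) n"
    by (simp add: fps_mult_nth)
qed

lemma fps_maj_prod:
  assumes "\<And>i. i \<in> I \<Longrightarrow> fps_maj (f i) (g i)"
  shows "fps_maj (\<Prod>i\<in>I. f i) (\<Prod>i\<in>I. g i)"
  using assms
proof (induction I rule: infinite_finite_induct)
  case (insert i I)
  then show ?case by (simp add: fps_maj_mult)
qed (auto simp: fps_maj_def fps_one_nth)

lemma fps_nth_inverse_one_minus_X_power: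
  fixes w :: "'a :: field"
  assumes "s > 0"
  shows "fps_nth (inverse (1 - fps_const w * fps_X ^ s)) n = (if s dvd n then w ^ (n div s) else 0)"
proof -
  define a where "a = (\<lambda>n. if s dvd n then w ^ (n div s) else 0)"
  have a1: "a n = w * a (n - s)" if "s \<le> n" for n
  proof -
    from that obtain k where k: "n = s + k" by (metis le_Suc_ex)
    show ?thesis unfolding k a_def using assms by (simp add: div_add_self1)
  qed
  have a2: "a n = (if n = 0 then 1 else 0)" if "n < s" for n
    using that assms by (auto simp: a_def dest: dvd_imp_le)
  have "(1 - fps_const w * fps_X ^ s) * Abs_fps a = 1"
  proof (rule fps_ext)
    fix n
    show "fps_nth ((1 - fps_const w * fps_X ^ s) * Abs_fps a) n = fps_nth 1 n"
      using assms a1[of n] a2[of n]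
      by (cases "n < s") (simp_all add: left_diff_distrib mult.assoc fps_X_power_mult_nth not_less)
  qed
  then have "inverse (1 - fps_const w * fps_X ^ s) = Abs_fps a"
    by (rule fps_inverse_unique)
  then show ?thesis by (simp add: a_def)
qed

text \<open>
  The coefficients on the left are geometric sums with ratio \<open>w\<close>, hence bounded; for \<open>w = 1\<close> they
  would grow linearly.
\<close>

lemma fps_maj_pair:
  fixes w :: complex
  assumes "norm w = 1" "w \<noteq> 1" "s > 0"
  shows "fps_maj (inverse (1 - fps_const w * fps_X ^ s) * inverse (1 - fps_const w * fps_X ^ (2 * s)))
           (fps_const (2 / norm (1 - w)) * inverse (1 - fps_X ^ s))"
  unfolding fps_maj_def
proof
  fix n
  define c where "c i = (if s dvd i then w ^ (i div s) else 0) *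
      (if 2 * s dvd n - i then w ^ ((n - i) div (2 * s)) else 0)" for i
  have eq: "fps_nth (inverse (1 - fps_const w * fps_X ^ s) * inverse (1 - fps_const w * fps_X ^ (2 * s))) n
      = (\<Sum>i=0..n. c i)"
    unfolding fps_mult_nth c_def using assms(3)
    by (simp add: fps_nth_inverse_one_minus_X_power)
  have rhs: "fps_nth (fps_const (2 / norm (1 - w)) * inverse (1 - fps_X ^ s)) n =
      (if s dvd n then 2 / norm (1 - w) else 0)"
    using fps_nth_inverse_one_minus_X_power[OF assms(3), of "1 :: real" n] by simp
  show "norm (fps_nth (inverse (1 - fps_const w * fps_X ^ s) * inverse (1 - fps_const w * fps_X ^ (2 * s))) n)
      \<le> fps_nth (fps_const (2 / norm (1 - w)) * inverse (1 - fps_X ^ s)) n"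
  proof (cases "s dvd n")
    case False
    have "c i = 0" if "i \<le> n" for i
    proof (rule ccontr)
      assume "c i \<noteq> 0"
      then have "s dvd i" "2 * s dvd n - i" by (auto simp: c_def split: if_splits)
      then have "s dvd i + (n - i)" by (meson dvd_add dvd_mult_right dvd_trans dvd_triv_right)
      then show False using False that by simp
    qed
    then show ?thesis unfolding eq rhs using False by simp
  next
    case True
    then obtain m where n: "n = s * m" by auto
    \<comment> \<open>With \<open>n = s * m\<close>, a term with \<open>b\<close> copies of
      \<open>2 * s\<close> has \<open>m - 2 * b\<close> copies of \<open>s\<close> and hence the
      weight \<open>w ^ (m - b)\<close>, where \<open>b\<close> runs up to half of \<open>m\<close>.
      All other terms of the convolution vanish.\<close>
    define B where "B = m div 2"
    have "(\<Sum>i=0..n. c i) = (\<Sum>i\<in>(\<lambda>b. n - 2 * s * b) ` {..B}. c i)"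
    proof (rule sum.mono_neutral_right)
      show "\<forall>i\<in>{0..n} - (\<lambda>b. n - 2 * s * b) ` {..B}. c i = 0"
      proof (rule ballI, rule ccontr)
        fix i assume i: "i \<in> {0..n} - (\<lambda>b. n - 2 * s * b) ` {..B}" "c i \<noteq> 0"
        then obtain b where b: "n - i = 2 * s * b" by (auto simp: c_def split: if_splits)
        then have "2 * s * b \<le> s * m" using n by (metis diff_le_self)
        then have "s * (2 * b) \<le> s * m" by (simp add: mult_ac)
        then have "2 * b \<le> m" using assms(3) by simp
        then have "b \<le> B" by (simp add: B_def)
        moreover have "i = n - 2 * s * b" using b i by auto
        ultimately show False using i by auto
      qed
    qed auto
    also have "\<dots> = (\<Sum>b\<le>B. c (n - 2 * s * b))"
    proof (subst sum.reindex)
      have le: "2 * s * b \<le> n" if "b \<le> B" for b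
      proof -
        have "2 * b \<le> m" using that by (auto simp: B_def)
        then have "s * (2 * b) \<le> s * m" by simp
        then show ?thesis by (simp add: n mult_ac)
      qed
      show "inj_on (\<lambda>b. n - 2 * s * b) {..B}"
      proof (rule inj_onI)
        fix b b' assume *: "b \<in> {..B}" "b' \<in> {..B}" "n - 2 * s * b = n - 2 * s * b'"
        have "2 * s * b = 2 * s * b'"
          using le[of b] le[of b'] * by (metis atMost_iff diff_diff_cancel)
        then show "b = b'" using assms(3) by simp
      qed
    qed simp
    also have "\<dots> = (\<Sum>b\<le>B. w ^ (m - B) * w ^ (B - b))"
    proof (rule sum.cong[OF refl])
      fix b assume "b \<in> {..B}"
      then have b: "b \<le> B" "2 * b \<le> m" by (auto simp: B_def)
      have 1: "n - 2 * s * b = s * (m - 2 * b)"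
        by (simp add: n diff_mult_distrib2 mult_ac)
      have 2: "n - (n - 2 * s * b) = 2 * s * b"
      proof -
        have "s * (2 * b) \<le> s * m" using b by simp
        then show ?thesis by (simp add: n mult_ac)
      qed
      have "c (n - 2 * s * b) = w ^ (m - 2 * b) * w ^ b"
        unfolding c_def 2 using assms(3) by (simp add: 1)
      also have "\<dots> = w ^ (m - B) * w ^ (B - b)"
        using b by (simp add: B_def flip: power_add)
      finally show "c (n - 2 * s * b) = w ^ (m - B) * w ^ (B - b)" .
    qed
    also have "\<dots> = w ^ (m - B) * (\<Sum>b\<le>B. w ^ b)"
      unfolding sum_distrib_left[symmetric]
      using sum.nat_diff_reindex[of "\<lambda>i. w ^ i" "Suc B"] by (simp add: lessThan_Suc_atMost)
    also have "norm \<dots> = norm (\<Sum>b\<le>B. w ^ b)"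
      using assms by (simp add: norm_mult norm_power)
    also have "(\<Sum>b\<le>B. w ^ b) = (1 - w ^ Suc B) / (1 - w)"
      using assms by (simp add: sum_gp_basic[symmetric] field_simps sum_gp0)
    also have "norm \<dots> \<le> 2 / norm (1 - w)"
      unfolding norm_divide
      by (intro divide_right_mono norm_triangle_le_diff) (use assms in \<open>simp_all add: norm_mult norm_power\<close>)
    finally show ?thesis unfolding eq rhs using True by simp
  qed
qed

text \<open>
  Five disjoint pairs \<open>(s, 2 s)\<close> of even sizes: each of them gains a factor \<open>1 - r\<close>, and the error has to
  beat \<open>\<sigma>\<^sup>-\<^sup>3\<close>, which has order \<open>(1 - r)\<^sup>9\<^sup>/\<^sup>2\<close>.
\<close>

definition Tlow :: "nat set" where "Tlow = (\<lambda>i. 2 * 4 ^ i) ` {..<5}"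
definition Thigh :: "nat set" where "Thigh = (\<lambda>i. 2 * (2 * 4 ^ i)) ` {..<5}"

lemma Tlow_eq: "Tlow = {2, 8, 32, 128, 512}" and Thigh_eq: "Thigh = {4, 16, 64, 256, 1024}"
  by (simp_all add: Tlow_def Thigh_def lessThan_nat_numeral lessThan_Suc insert_commute)

text \<open>Multiplying the bounds for the pairs leaves only the smaller size of each. The result is
  again a count, but the factors for \<open>Thigh\<close> have disappeared from its generating
  function: this is the gain.\<close>

lemma norm_mparts_T_le:
  fixes w :: complex
  assumes "norm w = 1" "w \<noteq> 1"
  shows "norm (\<Sum>\<tau>\<in>mparts (Tlow \<union> Thigh) n. w ^ size \<tau>)
           \<le> (2 / norm (1 - w)) ^ 5 * card (mparts Tlow n)"
proof -
  define g where "g j = inverse (1 - fps_const w * fps_X ^ j)" for j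
  have fin: "finite Tlow" "finite Thigh" "0 \<notin> Tlow" "0 \<notin> Thigh" "Tlow \<inter> Thigh = {}"
    by (auto simp: Tlow_eq Thigh_eq)
  have inj: "inj_on (\<lambda>i. 2 * 4 ^ i :: nat) {..<5}" "inj_on (\<lambda>i. 2 * (2 * 4 ^ i) :: nat) {..<5}"
    by (auto simp: inj_on_def)
  have "Abs_fps (\<lambda>n. \<Sum>\<tau>\<in>mparts (Tlow \<union> Thigh) n. w ^ size \<tau>) = (\<Prod>j\<in>Tlow \<union> Thigh. g j)"
    unfolding g_def using fin by (intro mparts_fps) auto
  also have "\<dots> = (\<Prod>j\<in>Tlow. g j) * (\<Prod>j\<in>Thigh. g j)"
    using fin by (intro prod.union_disjoint)
  also have "\<dots> = (\<Prod>i<5. g (2 * 4 ^ i) * g (2 * (2 * 4 ^ i)))"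
    unfolding Tlow_def Thigh_def prod.reindex[OF inj(1)] prod.reindex[OF inj(2)] o_def
    by (rule prod.distrib[symmetric])
  finally have 1: "Abs_fps (\<lambda>n. \<Sum>\<tau>\<in>mparts (Tlow \<union> Thigh) n. w ^ size \<tau>) = \<dots>" .
  have "fps_maj (\<Prod>i<5. g (2 * 4 ^ i) * g (2 * (2 * 4 ^ i)))
      (\<Prod>i<5. fps_const (2 / norm (1 - w)) * inverse (1 - fps_X ^ (2 * 4 ^ i)))"
    unfolding g_def using assms by (intro fps_maj_prod fps_maj_pair) auto
  also have "(\<Prod>i<5. fps_const (2 / norm (1 - w)) * inverse (1 - fps_X ^ (2 * 4 ^ i))) =
      fps_const ((2 / norm (1 - w)) ^ 5) * (\<Prod>j\<in>Tlow. inverse (1 - fps_X ^ j :: real fps))"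
    unfolding Tlow_def prod.reindex[OF inj(1)] o_def
    by (simp add: prod.distrib fps_const_power)
  also have "(\<Prod>j\<in>Tlow. inverse (1 - fps_X ^ j :: real fps)) =
      Abs_fps (\<lambda>n. real (card (mparts Tlow n)))"
    using mparts_fps[OF fin(1,3), of "1 :: real"] by simp
  finally show ?thesis
    unfolding 1[symmetric] fps_maj_def by simp
qed

section \<open>Convergence in the unit disc and bounds for coefficients\<close>

lemma fps_conv_radius_geI:
  fixes f :: "'a :: {banach, real_normed_div_algebra} fps"
  assumes "\<And>n. norm (fps_nth f n) \<le> 1"
  shows "fps_conv_radius f \<ge> 1"
  unfolding fps_conv_radius_def
proof (rule conv_radius_geI_ex')
  fix r :: real assume r: "0 < r" "ereal r < 1"
  have "norm (fps_nth f n * of_real r ^ n) \<le> r ^ n" for n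
    using assms[of n] r by (auto simp: norm_mult norm_power intro: mult_left_le_one_le)
  then show "summable (\<lambda>n. fps_nth f n * of_real r ^ n)"
    using r by (intro summable_comparison_test'[OF summable_geometric[of r]]) auto
qed

lemma fps_prod_eval:
  fixes f :: "'b \<Rightarrow> complex fps"
  assumes "\<And>j. j \<in> U \<Longrightarrow> fps_conv_radius (f j) \<ge> 1"
  shows "fps_conv_radius (\<Prod>j\<in>U. f j) \<ge> 1 \<and>
    (\<forall>q. norm q < 1 \<longrightarrow> eval_fps (\<Prod>j\<in>U. f j) q = (\<Prod>j\<in>U. eval_fps (f j) q))"
  using assms
proof (induction U rule: infinite_finite_induct)
  case (insert j U)
  then have IH: "fps_conv_radius (\<Prod>j\<in>U. f j) \<ge> 1" "fps_conv_radius (f j) \<ge> 1"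
      "\<And>q. norm q < 1 \<Longrightarrow> eval_fps (\<Prod>j\<in>U. f j) q = (\<Prod>j\<in>U. eval_fps (f j) q)"
    by auto
  have "fps_conv_radius (f j * (\<Prod>j\<in>U. f j)) \<ge> 1"
    by (rule order_trans[OF _ fps_conv_radius_mult]) (use IH in auto)
  moreover have "eval_fps (f j * (\<Prod>j\<in>U. f j)) q = eval_fps (f j) q * (\<Prod>j\<in>U. eval_fps (f j) q)"
    if "norm q < 1" for q
    using IH that
    by (subst eval_fps_mult) (auto intro: less_le_trans[where y = 1] simp: IH(3))
  ultimately show ?case using insert by simp
qed auto

lemma fps_conv_radius_opset:
  fixes U V :: "nat set"
  assumes "0 \<notin> V"
  defines "F \<equiv> (\<Prod>j\<in>U. 1 + fps_X ^ j) * (\<Prod>j\<in>V. inverse (1 - fps_X ^ j)) :: complex fps"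
  shows "fps_conv_radius F \<ge> 1"
    and "norm q < 1 \<Longrightarrow> eval_fps F q = (\<Prod>j\<in>U. 1 + q ^ j) * (\<Prod>j\<in>V. inverse (1 - q ^ j))"
proof -
  have c1: "fps_conv_radius (1 + fps_X ^ j :: complex fps) \<ge> 1" for j
    by (rule order_trans[OF _ fps_conv_radius_add]) auto
  have c2: "fps_conv_radius (inverse (1 - fps_X ^ j) :: complex fps) \<ge> 1" if "j \<in> V" for j
  proof (rule fps_conv_radius_geI)
    have "j > 0" using that assms by (cases j) auto
    then show "norm (fps_nth (inverse (1 - fps_X ^ j) :: complex fps) n) \<le> 1" for n
      using fps_nth_inverse_one_minus_X_power[of j "1 :: complex" n] by auto
  qed
  have e1: "eval_fps (1 + fps_X ^ j) q = 1 + q ^ j" for j and q :: complex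
    by (subst eval_fps_add) auto
  have e2: "eval_fps (inverse (1 - fps_X ^ j)) q = inverse (1 - q ^ j)"
    if "j \<in> V" "norm q < 1" for j and q :: complex
  proof -
    have "j > 0" using that assms by (cases j) auto
    then have "(1 - fps_X ^ j) * inverse (1 - fps_X ^ j) = (1 :: complex fps)"
      by (intro inverse_mult_eq_1') simp
    then have "eval_fps ((1 - fps_X ^ j) * inverse (1 - fps_X ^ j)) q = 1"
      by simp
    moreover have "fps_conv_radius (1 - fps_X ^ j :: complex fps) \<ge> 1"
      by (rule order_trans[OF _ fps_conv_radius_diff]) auto
    ultimately have "eval_fps (1 - fps_X ^ j) q * eval_fps (inverse (1 - fps_X ^ j)) q = 1"
      using c2[OF that(1)] that(2)
      by (subst (asm) eval_fps_mult) (auto intro: less_le_trans[where y = 1])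
    then show ?thesis
      by (subst (asm) eval_fps_diff) (auto simp: inverse_unique)
  qed
  note A = fps_prod_eval[of U "\<lambda>j. 1 + fps_X ^ j", OF c1]
  note B = fps_prod_eval[of V "\<lambda>j. inverse (1 - fps_X ^ j)", OF c2]
  show "fps_conv_radius F \<ge> 1"
    unfolding F_def using A B by (intro order_trans[OF _ fps_conv_radius_mult]) auto
  show "eval_fps F q = (\<Prod>j\<in>U. 1 + q ^ j) * (\<Prod>j\<in>V. inverse (1 - q ^ j))" if "norm q < 1"
    unfolding F_def using A B that
    by (subst eval_fps_mult) (auto intro: less_le_trans[where y = 1] simp: e1 e2)
qed

text \<open>All coefficients are nonnegative and \<open>r\<close> is positive, so one term of the
  series is at most the sum. The evaluation passes through the complex numbers, where the same
  product is later needed on a circle.\<close>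

lemma card_opset_le:
  fixes r :: real
  assumes "finite U" "finite V" "0 \<notin> V" "0 < r" "r < 1"
  shows "card (opset V U n) * r ^ n \<le> (\<Prod>j\<in>U. 1 + r ^ j) * (\<Prod>j\<in>V. inverse (1 - r ^ j))"
proof -
  define F where "F = ((\<Prod>j\<in>U. 1 + fps_X ^ j) * (\<Prod>j\<in>V. inverse (1 - fps_X ^ j)) :: complex fps)"
  have F: "fps_nth F k = of_nat (card (opset V U k))" for k
    unfolding F_def using assms by (intro opset_fps[symmetric])
  have "(\<lambda>k. fps_nth F k * complex_of_real r ^ k) sums eval_fps F (complex_of_real r)"
    using fps_conv_radius_opset(1)[OF assms(3), of U] assms unfolding F_def[symmetric]
    by (intro sums_eval_fps) (auto intro: less_le_trans[where y = 1])
  also have "eval_fps F (complex_of_real r) =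
      complex_of_real ((\<Prod>j\<in>U. 1 + r ^ j) * (\<Prod>j\<in>V. inverse (1 - r ^ j)))"
    unfolding F_def using assms by (subst fps_conv_radius_opset(2)) auto
  also have "(\<lambda>k. fps_nth F k * complex_of_real r ^ k) =
      (\<lambda>k. complex_of_real (card (opset V U k) * r ^ k))"
    by (simp add: F)
  finally have s: "(\<lambda>k. card (opset V U k) * r ^ k) sums
      ((\<Prod>j\<in>U. 1 + r ^ j) * (\<Prod>j\<in>V. inverse (1 - r ^ j)))"
    by (simp only: sums_of_real_iff)
  have "(\<Sum>k\<in>{n}. card (opset V U k) * r ^ k) \<le> (\<Sum>k. card (opset V U k) * r ^ k)"
    using s assms by (intro sum_le_suminf) (auto dest: sums_summable)
  then show ?thesis using s by (simp add: sums_iff)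
qed

definition overprod :: "nat \<Rightarrow> real \<Rightarrow> real" where
  "overprod N r = (\<Prod>j\<in>{1..N}. (1 + r ^ j) / (1 - r ^ j))"

text \<open>Omitting the factor \<open>inverse (1 - r ^ j)\<close> multiplies the product by
  \<open>1 - r ^ j\<close>, which is at most \<open>j * (1 - r)\<close> by Bernoulli's inequality;
  all remaining factors are at least 1 and may be restored. Each omitted size gains one power of
  \<open>1 - r\<close>.\<close>

lemma restricted_overprod_le:
  assumes "U \<subseteq> {1..N}" "V \<subseteq> {1..N}" "T \<subseteq> {1..N}" "V \<inter> T = {}" "0 < r" "r < 1"
  shows "(\<Prod>j\<in>U. 1 + r ^ j) * (\<Prod>j\<in>V. inverse (1 - r ^ j))
           \<le> (\<Prod>j\<in>T. real j) * (1 - r) ^ card T * overprod N r"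
proof -
  have fin: "finite U" "finite V" "finite T"
    using assms by (auto intro: finite_subset)
  have pos: "0 < 1 - r ^ j" "1 - r ^ j \<le> 1" if "j \<in> {1..N}" for j
    using that assms by (auto simp: power_Suc_less_one power_less_one_iff)
  have a1: "(\<Prod>j\<in>U. 1 + r ^ j) \<le> (\<Prod>j\<in>{1..N}. 1 + r ^ j)"
    using assms by (intro prod_mono2) auto
  have a2: "(\<Prod>j\<in>V. inverse (1 - r ^ j)) \<le> (\<Prod>j\<in>{1..N} - T. inverse (1 - r ^ j))"
  proof (rule prod_mono2)
    have 1: "1 \<le> inverse (1 - r ^ j)" if "j \<in> {1..N}" for j
      using pos[OF that] by (rule one_le_inverse)
    show "1 \<le> inverse (1 - r ^ j)" if "j \<in> {1..N} - T - V" for j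
      using that by (intro 1) auto
    show "0 \<le> inverse (1 - r ^ j)" if "j \<in> V" for j
      using that assms by (intro order_trans[OF _ 1]) auto
  qed (use assms in auto)
  have a3: "(\<Prod>j\<in>{1..N} - T. inverse (1 - r ^ j)) =
      (\<Prod>j\<in>{1..N}. inverse (1 - r ^ j)) * (\<Prod>j\<in>T. 1 - r ^ j)"
  proof -
    have "(\<Prod>j\<in>{1..N}. inverse (1 - r ^ j)) =
        (\<Prod>j\<in>{1..N} - T. inverse (1 - r ^ j)) * (\<Prod>j\<in>T. inverse (1 - r ^ j))"
      using assms by (intro prod.subset_diff) auto
    moreover have "(\<Prod>j\<in>T. inverse (1 - r ^ j)) * (\<Prod>j\<in>T. 1 - r ^ j) = 1"
      unfolding prod.distrib[symmetric]
    proof (rule prod.neutral, safe)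
      fix j assume "j \<in> T"
      then have "1 - r ^ j \<noteq> 0" using pos[of j] assms by auto
      then show "inverse (1 - r ^ j) * (1 - r ^ j) = 1" by simp
    qed
    ultimately show ?thesis by simp
  qed
  have a4: "(\<Prod>j\<in>T. 1 - r ^ j) \<le> (\<Prod>j\<in>T. real j * (1 - r))"
  proof (rule prod_mono, safe)
    fix j assume "j \<in> T"
    then show "0 \<le> 1 - r ^ j" using pos[of j] assms by auto
    show "1 - r ^ j \<le> real j * (1 - r)"
      using Bernoulli_inequality[of "r - 1" j] assms by (simp add: algebra_simps)
  qed
  have n1: "0 \<le> inverse (1 - r ^ j)" if "j \<in> {1..N}" for j
    using pos[OF that] by simp
  have "(\<Prod>j\<in>V. inverse (1 - r ^ j)) \<le>
      (\<Prod>j\<in>{1..N}. inverse (1 - r ^ j)) * (\<Prod>j\<in>T. real j * (1 - r))"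
    using a2 unfolding a3 by (rule order_trans) (intro mult_left_mono a4 prod_nonneg n1)
  with a1 have "(\<Prod>j\<in>U. 1 + r ^ j) * (\<Prod>j\<in>V. inverse (1 - r ^ j)) \<le>
    (\<Prod>j\<in>{1..N}. 1 + r ^ j) * ((\<Prod>j\<in>{1..N}. inverse (1 - r ^ j)) * (\<Prod>j\<in>T. real j * (1 - r)))"
  proof (rule mult_mono)
    show "0 \<le> (\<Prod>j\<in>{1..N}. 1 + r ^ j)"
      using assms by (intro prod_nonneg) (auto intro: add_nonneg_nonneg)
    show "0 \<le> (\<Prod>j\<in>V. inverse (1 - r ^ j))"
      using assms by (intro prod_nonneg n1) auto
  qed
  also have "\<dots> = (\<Prod>j\<in>T. real j) * (1 - r) ^ card T * overprod N r"
    by (simp add: overprod_def prod.distrib divide_inverse mult_ac)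
  finally show ?thesis .
qed

section \<open>The rank under insertion of small even parts\<close>

definition op_largest :: "nat multiset \<times> nat set \<Rightarrow> nat" where
  "op_largest p = largest_part (fst p + mset_set (snd p), snd p)"

definition op_rank :: "nat multiset \<times> nat set \<Rightarrow> int" where
  "op_rank p = M2_rank (fst p + mset_set (snd p), snd p)"

lemma op_largest_eq: "finite S \<Longrightarrow> op_largest (R, S) = Max (insert 0 (set_mset R \<union> S))"
  unfolding op_largest_def largest_part_def
  by (auto simp: mset_set_empty_iff Max_insert)

text \<open>The overpartitions are split by whether the largest part exceeds \<open>m\<close>, and
  this has to be independent of the \<open>\<tau>\<close> summed over afterwards.\<close>

lemma op_largest_add:
  assumes "finite S" "\<And>j. j \<in># \<tau> \<Longrightarrow> j \<le> m"
  shows "op_largest (R + \<tau>, S) > m \<longleftrightarrow> op_largest (R, S) > m"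
    and "op_largest (R, S) > m \<Longrightarrow> op_largest (R + \<tau>, S) = op_largest (R, S)"
proof -
  have "insert 0 (set_mset (R + \<tau>) \<union> S) = insert 0 (set_mset R \<union> S) \<union> insert 0 (set_mset \<tau>)"
    by auto
  then have 1: "op_largest (R + \<tau>, S) = max (op_largest (R, S)) (Max (insert 0 (set_mset \<tau>)))"
    using assms(1) by (simp only: op_largest_eq) (rule Max_Un, auto)
  obtain b where "b \<le> m" "op_largest (R + \<tau>, S) = max (op_largest (R, S)) b"
  proof (rule that[OF _ 1])
    show "Max (insert 0 (set_mset \<tau>)) \<le> m"
      using assms(2) by (subst Max_le_iff) auto
  qed
  then show "op_largest (R + \<tau>, S) > m \<longleftrightarrow> op_largest (R, S) > m"
      "op_largest (R, S) > m \<Longrightarrow> op_largest (R + \<tau>, S) = op_largest (R, S)"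
    by auto
qed

text \<open>Parts below the largest one change neither the largest part nor \<chi>, and even parts
  do not change the number of odd non-overlined parts. What remains is the number of parts.\<close>

lemma op_rank_add:
  assumes "finite S" "\<And>j. j \<in># \<tau> \<Longrightarrow> j \<le> m" "\<And>j. j \<in># \<tau> \<Longrightarrow> even j" "op_largest (R, S) > m"
  shows "op_rank (R + \<tau>, S) = op_rank (R, S) - int (size \<tau>)"
proof -
  have "filter_mset odd \<tau> = {#}"
    using assms(3) by (auto simp: multiset_eq_iff count_eq_zero_iff)
  then have "num_odd_non_overlined (R + \<tau> + mset_set S, S) =
      num_odd_non_overlined (R + mset_set S, S)"
    by (simp add: num_odd_non_overlined_def non_overlined_def)
  moreover have "largest_part (R + \<tau> + mset_set S, S) = largest_part (R + mset_set S, S)"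
    using op_largest_add(2)[OF assms(1,2,4)] by (simp add: op_largest_def)
  ultimately show ?thesis
    by (simp add: op_rank_def M2_rank_def num_parts_def overpart_chi_def)
qed

lemma sum_overpartitions:
  assumes "n \<le> N"
  shows "(\<Sum>p | overpartition_of n p. f p) =
    (\<Sum>p\<in>opset {1..N} {1..N} n. f (fst p + mset_set (snd p), snd p))"
  using sum.reindex_bij_betw[OF bij_betw_overpartitions[OF assms], of f]
  by (simp add: case_prod_beta')

text \<open>Here \<open>e\<close> is a nontrivial character of the integers, and 1024 is the largest
  exchanged size. If the largest part exceeds it, the exchanged sizes contribute an independent sum
  with cancellation; the other overpartitions are so few that absolute values suffice.\<close>

lemma norm_sum_op_rank_le:
  fixes e :: "int \<Rightarrow> complex"
  assumes add: "\<And>x y. e (x + y) = e x * e y" and norm: "\<And>x. norm (e x) = 1" and e1: "e (- 1) \<noteq> 1"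
  assumes "n \<le> N" "1029 \<le> N" "0 < r" "r < 1"
  shows "norm (\<Sum>p | overpartition_of n p. e (M2_rank p)) * r ^ n \<le>
    ((\<Prod>j\<in>{1025..1029}. real j) + (2 / norm (1 - e (- 1))) ^ 5 * (\<Prod>j\<in>Thigh. real j)) *
      (1 - r) ^ 5 * overprod N r"
proof -
  define w where "w = e (- 1)"
  define T where "T = Tlow \<union> Thigh"
  define I where "I = {1..N}"
  define V0 where "V0 = I - T"
  have w: "norm w = 1" "w \<noteq> 1" using norm e1 by (simp_all add: w_def)
  have e_diff: "e (x - int k) = e x * w ^ k" for x k
  proof (induction k)
    case (Suc k)
    have "e (x - int (Suc k)) = e ((x - int k) + (- 1))" by (simp add: algebra_simps)
    also have "\<dots> = e x * w ^ Suc k" unfolding add Suc w_def[symmetric] by simp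
    finally show ?case .
  qed simp
  have T: "T \<subseteq> {1..1024}" "Tlow \<subseteq> T" "Thigh \<subseteq> T" "Tlow \<inter> Thigh = {}" "0 \<notin> T" "\<And>j. j \<in> T \<Longrightarrow> even j"
      "card Thigh = 5"
    by (auto simp: T_def Tlow_eq Thigh_eq)
  have TI: "T \<subseteq> I" using T(1) assms(5) by (fastforce simp: I_def)
  have I: "finite I" "0 \<notin> I" "I = V0 \<union> T" "V0 \<inter> T = {}" "V0 \<inter> Tlow = {}" "0 \<notin> V0"
    using TI T by (auto simp: I_def V0_def)
  define f where "f p = (if op_largest p > 1024 then e (op_rank p) else 0)" for p
  define g where "g p = (if op_largest p > 1024 then 0 else e (op_rank p))" for p
  have "(\<Sum>p | overpartition_of n p. e (M2_rank p)) = (\<Sum>p\<in>opset I I n. f p + g p)"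
    unfolding sum_overpartitions[OF assms(4)] I_def op_rank_def[symmetric]
    by (rule sum.cong) (auto simp: f_def g_def)
  then have split: "norm (\<Sum>p | overpartition_of n p. e (M2_rank p)) \<le>
      norm (\<Sum>p\<in>opset I I n. g p) + norm (\<Sum>p\<in>opset I I n. f p)"
    by (simp add: sum.distrib norm_triangle_ineq add.commute)

  have "norm (\<Sum>p\<in>opset I I n. g p) \<le> (\<Sum>p\<in>opset I I n. norm (g p))"
    by (rule norm_sum)
  also have "\<dots> = (\<Sum>p\<in>{p\<in>opset I I n. op_largest p \<le> 1024}. 1)"
    using finite_opset[OF I(1,2)] by (intro sum.mono_neutral_cong_right) (auto simp: g_def norm)
  also have "\<dots> \<le> card (opset {1..1024} {1..1024} n)"
  proof -
    have "{p\<in>opset I I n. op_largest p \<le> 1024} \<subseteq> opset {1..1024} {1..1024} n"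
    proof safe
      fix R S assume *: "(R, S) \<in> opset I I n" "op_largest (R, S) \<le> 1024"
      then have "finite S" using I by (auto simp: opset_def rparts_def intro: finite_subset)
      then have "\<forall>x\<in>set_mset R \<union> S. x \<le> 1024"
        using * by (auto simp: op_largest_eq)
      then show "(R, S) \<in> opset {1..1024} {1..1024} n"
        using * by (fastforce simp: opset_def rparts_def I_def)
    qed
    then show ?thesis by (simp add: card_mono finite_opset)
  qed
  finally have "norm (\<Sum>p\<in>opset I I n. g p) * r ^ n \<le> card (opset {1..1024} {1..1024} n) * r ^ n"
    using assms by (intro mult_right_mono) auto
  also have "\<dots> \<le> (\<Prod>j\<in>{1..1024}. 1 + r ^ j) * (\<Prod>j\<in>{1..1024}. inverse (1 - r ^ j))"
    using assms by (intro card_opset_le) auto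
  \<comment> \<open>If no part exceeds 1024, the five sizes 1025 to 1029 are missing, which gains
    the same fifth power of \<open>1 - r\<close>. This is the origin of the requirement
    \<open>1029 \<le> N\<close>.\<close>
  also have "\<dots> \<le> (\<Prod>j\<in>{1025..1029}. real j) * (1 - r) ^ card {1025..1029::nat} * overprod N r"
    using assms by (intro restricted_overprod_le) auto
  finally have small: "norm (\<Sum>p\<in>opset I I n. g p) * r ^ n \<le>
      (\<Prod>j\<in>{1025..1029}. real j) * (1 - r) ^ 5 * overprod N r" by simp

  define B where "B = {p \<in> rparts V0 I. wt p \<le> n}"
  have finB: "finite B"
  proof (rule finite_subset)
    show "B \<subseteq> (\<Union>l\<le>n. opset V0 I l)" by (auto simp: B_def opset_def)
  qed (use I in \<open>auto simp: finite_opset\<close>)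
  have "(\<Sum>p\<in>opset I I n. f p) = (\<Sum>p\<in>opset (V0 \<union> T) I n. f p)"
    using I by simp
  also have "\<dots> = (\<Sum>(p, \<tau>)\<in>(SIGMA p:B. mparts T (n - wt p)). f (fst p + \<tau>, snd p))"
    unfolding B_def
    using sum.reindex_bij_betw[OF bij_betw_opset_Un[OF I(4) I(1)], of f n]
    by (simp add: case_prod_beta')
  also have "\<dots> = (\<Sum>p\<in>B. \<Sum>\<tau>\<in>mparts T (n - wt p). f (fst p + \<tau>, snd p))"
    using finB T by (subst sum.Sigma) (auto simp: finite_mparts)
  also have "\<dots> = (\<Sum>p\<in>B. \<Sum>\<tau>\<in>mparts T (n - wt p). f p * w ^ size \<tau>)"
  proof (intro sum.cong refl)
    fix p \<tau> assume p: "p \<in> B" and \<tau>: "\<tau> \<in> mparts T (n - wt p)"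
    have fin: "finite (snd p)"
      using p I(1) by (auto simp: B_def rparts_def intro: finite_subset)
    have \<tau>1: "j \<le> 1024" "even j" if "j \<in># \<tau>" for j
      using that \<tau> T(1,6) by (auto simp: mparts_def)
    show "f (fst p + \<tau>, snd p) = f p * w ^ size \<tau>"
      using op_largest_add(1)[of "snd p" \<tau> 1024 "fst p", OF fin \<tau>1(1)]
        op_rank_add[of "snd p" \<tau> 1024 "fst p", OF fin \<tau>1]
      by (simp add: f_def e_diff)
  qed
  finally have "norm (\<Sum>p\<in>opset I I n. f p) \<le> (\<Sum>p\<in>B. norm (\<Sum>\<tau>\<in>mparts T (n - wt p). f p * w ^ size \<tau>))"
    by (simp add: norm_sum)
  also have "\<dots> \<le> (\<Sum>p\<in>B. (2 / norm (1 - w)) ^ 5 * card (mparts Tlow (n - wt p)))"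
  proof (rule sum_mono)
    fix p
    have "norm (\<Sum>\<tau>\<in>mparts T (n - wt p). f p * w ^ size \<tau>) =
        norm (f p) * norm (\<Sum>\<tau>\<in>mparts T (n - wt p). w ^ size \<tau>)"
      by (simp add: norm_mult flip: sum_distrib_left)
    also have "\<dots> \<le> 1 * norm (\<Sum>\<tau>\<in>mparts T (n - wt p). w ^ size \<tau>)"
      by (intro mult_right_mono) (auto simp: f_def norm)
    also have "\<dots> \<le> (2 / norm (1 - w)) ^ 5 * card (mparts Tlow (n - wt p))"
      using norm_mparts_T_le[OF w] by (simp add: T_def)
    finally show "norm (\<Sum>\<tau>\<in>mparts T (n - wt p). f p * w ^ size \<tau>) \<le>
        (2 / norm (1 - w)) ^ 5 * card (mparts Tlow (n - wt p))" .
  qed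
  \<comment> \<open>The splitting is now read backwards with \<open>Tlow\<close> alone: the majorant
    counts the overpartitions of \<open>n\<close> without non-overlined parts in
    \<open>Thigh\<close>.\<close>
  also have "\<dots> = (2 / norm (1 - w)) ^ 5 * card (opset (V0 \<union> Tlow) I n)"
  proof -
    have "card (opset (V0 \<union> Tlow) I n) = card (SIGMA p:B. mparts Tlow (n - wt p))"
      using bij_betw_same_card[OF bij_betw_opset_Un[OF I(5) I(1), of n]] by (simp add: B_def)
    also have "\<dots> = (\<Sum>p\<in>B. card (mparts Tlow (n - wt p)))"
      using finB T by (intro card_SigmaI) (auto intro!: finite_mparts)
    finally show ?thesis by (simp add: sum_distrib_left)
  qed
  finally have "norm (\<Sum>p\<in>opset I I n. f p) * r ^ n \<le>
      (2 / norm (1 - w)) ^ 5 * card (opset (V0 \<union> Tlow) I n) * r ^ n"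
    using assms by (intro mult_right_mono) auto
  also have "\<dots> = (2 / norm (1 - w)) ^ 5 * (card (opset (V0 \<union> Tlow) I n) * r ^ n)"
    by (simp add: mult_ac)
  also have "\<dots> \<le> (2 / norm (1 - w)) ^ 5 *
      ((\<Prod>j\<in>Thigh. real j) * (1 - r) ^ card Thigh * overprod N r)"
  proof (intro mult_left_mono)
    have V: "V0 \<union> Tlow \<subseteq> I" "0 \<notin> V0 \<union> Tlow" "(V0 \<union> Tlow) \<inter> Thigh = {}" "Thigh \<subseteq> I"
      using I(3,6) T(2-5) TI by (auto simp: V0_def)
    have "card (opset (V0 \<union> Tlow) I n) * r ^ n \<le>
        (\<Prod>j\<in>I. 1 + r ^ j) * (\<Prod>j\<in>V0 \<union> Tlow. inverse (1 - r ^ j))"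
      using V by (intro card_opset_le assms(6,7) I finite_subset[OF _ I(1)])
    also have "\<dots> \<le> (\<Prod>j\<in>Thigh. real j) * (1 - r) ^ card Thigh * overprod N r"
      using V unfolding I_def by (intro restricted_overprod_le assms(6,7)) auto
    finally show "card (opset (V0 \<union> Tlow) I n) * r ^ n \<le>
        (\<Prod>j\<in>Thigh. real j) * (1 - r) ^ card Thigh * overprod N r" .
  qed auto
  finally have big: "norm (\<Sum>p\<in>opset I I n. f p) * r ^ n \<le>
      (2 / norm (1 - w)) ^ 5 * (\<Prod>j\<in>Thigh. real j) * (1 - r) ^ 5 * overprod N r"
    by (simp add: T mult_ac)

  have "norm (\<Sum>p | overpartition_of n p. e (M2_rank p)) * r ^ n \<le>
      (norm (\<Sum>p\<in>opset I I n. g p) + norm (\<Sum>p\<in>opset I I n. f p)) * r ^ n"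
    using split assms by (intro mult_right_mono) auto
  also have "\<dots> \<le> (\<Prod>j\<in>{1025..1029}. real j) * (1 - r) ^ 5 * overprod N r +
      (2 / norm (1 - w)) ^ 5 * (\<Prod>j\<in>Thigh. real j) * (1 - r) ^ 5 * overprod N r"
    unfolding distrib_right using small big by (rule add_mono)
  finally show ?thesis by (simp only: distrib_right w_def)
qed

section \<open>Comparison of a residue class with the full count\<close>

lemma sum_cis_multiples:
  fixes c :: nat and m :: int
  assumes "c > 0"
  shows "(\<Sum>k<c. cis (2 * pi * real k * real_of_int m / c)) = (if int c dvd m then of_nat c else 0)"
proof -
  define z where "z = cis (2 * pi * real_of_int m / c)"
  have pow: "cis (2 * pi * real k * real_of_int m / c) = z ^ k" for k
    by (simp add: z_def Complex.DeMoivre mult_ac)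
  have zc: "z ^ c = 1"
  proof -
    have "z ^ c = cis (2 * pi * of_int m)"
      using assms by (simp add: z_def Complex.DeMoivre)
    then show ?thesis by simp
  qed
  have z1: "z = 1 \<longleftrightarrow> int c dvd m"
  proof
    assume "z = 1"
    then have "cos (2 * pi * real_of_int m / c) = 1"
      by (simp add: z_def complex_eq_iff)
    then obtain k :: int where "2 * pi * real_of_int m / c = k * (2 * pi)"
      using cos_one_2pi_int by (metis mult.assoc mult.commute)
    then have "real_of_int m = real_of_int (int c * k)"
      using assms by (simp add: field_simps)
    then show "int c dvd m" by (metis dvd_triv_left of_int_eq_iff)
  next
    assume "int c dvd m"
    then obtain k where "m = int c * k" by auto
    then have "2 * pi * real_of_int m / c = 2 * pi * of_int k" using assms by simp
    then show "z = 1" unfolding z_def by (simp add: cis_multiple_2pi)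
  qed
  show ?thesis
  proof (cases "z = 1")
    case True
    then show ?thesis using z1 by (simp add: pow)
  next
    case False
    then have "(\<Sum>k<c. z ^ k) = 0"
      using zc by (simp add: sum_gp_strict)
    then show ?thesis using z1 False by (simp add: pow)
  qed
qed

definition pbar :: "nat \<Rightarrow> nat" where
  "pbar n = card {p. overpartition_of n p}"

text \<open>Orthogonality writes \<open>c\<close> times the indicator of a residue class as a sum of
  characters. The trivial one yields the full count, each other one cancels. The constant is
  independent of \<open>n\<close>, \<open>N\<close> and \<open>r\<close>, so \<open>r\<close> may
  later be tied to \<open>n\<close>.\<close>

lemma N2bar_approx:
  assumes "c \<ge> 2"
  obtains C where "C \<ge> 0"
    "\<And>n N r. n \<le> N \<Longrightarrow> 1029 \<le> N \<Longrightarrow> 0 < r \<Longrightarrow> r < 1 \<Longrightarrow>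
       \<bar>real_of_int c * N2bar a c n - pbar n\<bar> * r ^ n \<le> C * (1 - r) ^ 5 * overprod N r"
proof -
  obtain d where d: "c = int d" "d \<ge> 2" using assms by (metis int_nat_eq nat_le_iff of_nat_le_iff of_nat_numeral order_trans zero_le_numeral)
  define e where "e k m = cis (2 * pi * real k * real_of_int m / d)" for k :: nat and m :: int
  have e_add: "e k (x + y) = e k x * e k y" for k x y
    by (simp add: e_def cis_mult add_divide_distrib distrib_left)
  have e_norm: "norm (e k x) = 1" for k x
    by (simp add: e_def)
  have e_ne: "e k (- 1) \<noteq> 1" if "k \<in> {1..<d}" for k
  proof
    assume "e k (- 1) = 1"
    then have "cos (2 * pi * real k / d) = 1"
      by (simp add: e_def complex_eq_iff)
    then obtain l :: int where "2 * pi * real k / d = l * (2 * pi)"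
      using cos_one_2pi_int by (metis mult.assoc mult.commute)
    then have "real_of_int (int k) = real_of_int (int d * l)"
      using d by (simp add: field_simps)
    then have "int d dvd int k" by (metis dvd_triv_left of_int_eq_iff)
    then show False using that by (auto dest: zdvd_imp_le)
  qed
  define K where "K k = (\<Prod>j\<in>{1025..1029}. real j) +
      (2 / norm (1 - e k (- 1))) ^ 5 * (\<Prod>j\<in>Thigh. real j)" for k
  have K: "K k \<ge> 0" for k unfolding K_def
    by (intro add_nonneg_nonneg mult_nonneg_nonneg prod_nonneg) auto
  show ?thesis
  proof (rule that[of "\<Sum>k\<in>{1..<d}. K k"])
    show "0 \<le> (\<Sum>k\<in>{1..<d}. K k)" using K by (intro sum_nonneg) auto
    fix n N :: nat and r :: real
    assume n: "n \<le> N" "1029 \<le> N" "0 < r" "r < 1"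
    have fin: "finite {p. overpartition_of n p}" by (rule finite_overpartitions)
    have "complex_of_real (real_of_int c * N2bar a c n) =
        (\<Sum>p | overpartition_of n p. if int d dvd (M2_rank p - a) then of_nat d else 0)"
      using fin by (simp add: N2bar_def d cong_iff_dvd_diff sum.If_cases Int_def)
    also have "\<dots> = (\<Sum>p | overpartition_of n p. \<Sum>k<d. e k (M2_rank p - a))"
      unfolding e_def using d by (subst sum_cis_multiples) auto
    also have "\<dots> = (\<Sum>k<d. \<Sum>p | overpartition_of n p. e k (M2_rank p - a))"
      by (rule sum.swap)
    also have "{..<d} = insert 0 {1..<d}" using d by auto
    also have "(\<Sum>k\<in>insert 0 {1..<d}. \<Sum>p | overpartition_of n p. e k (M2_rank p - a)) =
      pbar n + (\<Sum>k\<in>{1..<d}. \<Sum>p | overpartition_of n p. e k (M2_rank p - a))"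
      by (subst sum.insert) (auto simp: e_def pbar_def)
    finally have "complex_of_real (real_of_int c * N2bar a c n - pbar n) =
        (\<Sum>k\<in>{1..<d}. \<Sum>p | overpartition_of n p. e k (M2_rank p - a))"
      by simp
    then have "\<bar>real_of_int c * N2bar a c n - pbar n\<bar> =
        norm (\<Sum>k\<in>{1..<d}. \<Sum>p | overpartition_of n p. e k (M2_rank p - a))"
      by (metis norm_of_real)
    also have "\<dots> \<le> (\<Sum>k\<in>{1..<d}. norm (\<Sum>p | overpartition_of n p. e k (M2_rank p - a)))"
      by (rule norm_sum)
    also have "\<dots> = (\<Sum>k\<in>{1..<d}. norm (\<Sum>p | overpartition_of n p. e k (M2_rank p)))"
    proof (rule sum.cong[OF refl])
      fix k
      have "(\<Sum>p | overpartition_of n p. e k (M2_rank p - a)) =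
          e k (- a) * (\<Sum>p | overpartition_of n p. e k (M2_rank p))"
        by (simp add: sum_distrib_left flip: e_add)
      then show "norm (\<Sum>p | overpartition_of n p. e k (M2_rank p - a)) =
          norm (\<Sum>p | overpartition_of n p. e k (M2_rank p))"
        by (simp add: norm_mult e_norm)
    qed
    finally have "\<bar>real_of_int c * N2bar a c n - pbar n\<bar> * r ^ n \<le>
        (\<Sum>k\<in>{1..<d}. norm (\<Sum>p | overpartition_of n p. e k (M2_rank p))) * r ^ n"
      using n by (intro mult_right_mono) auto
    also have "\<dots> \<le> (\<Sum>k\<in>{1..<d}. K k * (1 - r) ^ 5 * overprod N r)"
      unfolding sum_distrib_right K_def
      by (intro sum_mono norm_sum_op_rank_le e_add e_norm e_ne n)
    finally show "\<bar>real_of_int c * N2bar a c n - pbar n\<bar> * r ^ n \<le>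
        (\<Sum>k\<in>{1..<d}. K k) * (1 - r) ^ 5 * overprod N r"
      by (simp add: sum_distrib_right)
  qed
qed

section \<open>The logarithm of the generating function\<close>

text \<open>
  The logarithm of the product of \<open>(1 + q\<^sup>j) / (1 - q\<^sup>j)\<close> over \<open>j \<ge> 1\<close> is the sum of \<open>oddw m * q\<^sup>j\<^sup>m\<close> over
  \<open>j \<ge> 1\<close> and all \<open>m\<close>. The index \<open>(m, j)\<close> below stands for the exponent \<open>m * (j + 1)\<close>.
\<close>

definition oddw :: "nat \<Rightarrow> real" where
  "oddw m = (if odd m then 2 / real m else 0)"

definition frq :: "nat \<times> nat \<Rightarrow> real" where
  "frq p = real (fst p * Suc (snd p))"

definition amp :: "real \<Rightarrow> nat \<times> nat \<Rightarrow> real" where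
  "amp x p = oddw (fst p) * exp (- (x * frq p))"

text \<open>\<open>mom 0 x\<close> is the logarithm of P(exp (- x)). The further
  \<open>mom i x\<close> are its derivatives up to sign, that is, the cumulants of the law in which
  \<open>n\<close> has probability proportional to \<open>pbar n * exp (- x) ^ n\<close>: mean,
  variance and third cumulant for i = 1, 2, 3.\<close>

definition mom :: "nat \<Rightarrow> real \<Rightarrow> real" where
  "mom i x = (\<Sum>\<^sub>\<infinity>p. amp x p * frq p ^ i)"

lemma oddw_nonneg [simp]: "0 \<le> oddw m" and frq_nonneg [simp]: "0 \<le> frq p"
  and amp_nonneg [simp]: "0 \<le> amp x p"
  by (simp_all add: oddw_def frq_def amp_def)

text \<open>The sum over the second index is geometric and at most \<open>oddw m / (x * m)\<close>,
  because exp y - 1 \<ge> y. The sum over the first index then converges like that of the inverse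
  squares.\<close>

lemma summable_amp: "x > 0 \<Longrightarrow> amp x summable_on UNIV"
  and mom_0_bound: "\<exists>Z>0. \<forall>x>0. mom 0 x \<le> Z / x"
proof -
  have Zs: "(\<lambda>m. oddw m / real m) summable_on UNIV"
  proof (rule summable_on_comparison_test)
    have "summable (\<lambda>m. inverse (real m ^ 2))"
      by (rule inverse_power_summable) simp
    then have "summable (\<lambda>m. norm (2 * inverse (real m ^ 2)))"
      by simp
    then show "(\<lambda>m. 2 * inverse (real m ^ 2)) summable_on UNIV"
      by (rule norm_summable_imp_summable_on)
  qed (auto simp: oddw_def power2_eq_square field_simps)
  define Z where "Z = (\<Sum>\<^sub>\<infinity>m. oddw m / real m)"
  define g where "g x m = oddw m * (exp (- (x * real m)) / (1 - exp (- (x * real m))))"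
    for x :: real and m
  have inner: "((\<lambda>j. amp x (m, j)) has_sum g x m) UNIV" if "x > 0" for x m
  proof (cases "m = 0")
    case True
    then show ?thesis by (simp add: amp_def oddw_def g_def)
  next
    case False
    define y where "y = exp (- (x * real m))"
    have y: "0 < y" "y < 1" using that False by (auto simp: y_def)
    have "(\<lambda>j. oddw m * (y * y ^ j)) sums (oddw m * (y * (1 / (1 - y))))"
      using y by (intro sums_mult geometric_sums) auto
    moreover have "amp x (m, j) = oddw m * (y * y ^ j)" for j
      by (simp add: amp_def frq_def y_def algebra_simps flip: exp_of_nat_mult exp_add)
    ultimately have "(\<lambda>j. amp x (m, j)) sums g x m"
      by (simp add: g_def y_def)
    then show ?thesis by (rule sums_nonneg_imp_has_sum) simp
  qed
  have gle: "0 \<le> g x m \<and> g x m \<le> (1 / x) * (oddw m / real m)" if "x > 0" for x m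
  proof (cases "m = 0")
    case True
    then show ?thesis by (simp add: oddw_def g_def)
  next
    case False
    have u: "x * real m > 0" using that False by simp
    have "x * real m \<le> exp (x * real m) - 1"
      using exp_ge_add_one_self[of "x * real m"] by linarith
    then have "1 / (exp (x * real m) - 1) \<le> 1 / (x * real m)"
      using u by (intro divide_left_mono) auto
    moreover have "exp (- (x * real m)) / (1 - exp (- (x * real m))) = 1 / (exp (x * real m) - 1)"
      using u by (simp add: exp_minus field_simps)
    ultimately have "g x m \<le> oddw m * (1 / (x * real m))"
      unfolding g_def by (intro mult_left_mono) auto
    moreover have "0 \<le> g x m"
      unfolding g_def using u by (intro mult_nonneg_nonneg divide_nonneg_nonneg) auto
    ultimately show ?thesis by simp
  qed
  have gs: "g x summable_on UNIV" if "x > 0" for x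
    using gle[OF that] by (intro summable_on_comparison_test[OF summable_on_cmult_right[OF Zs, of "1 / x"]]) auto
  show s: "amp x summable_on UNIV" if "x > 0" for x
  proof -
    have "amp x summable_on (UNIV \<times> UNIV)"
      using inner[OF that] gs[OF that] by (rule summable_on_SigmaI) auto
    then show ?thesis by simp
  qed
  have "mom 0 x \<le> Z / x" if "x > 0" for x
  proof -
    have "(amp x has_sum mom 0 x) (UNIV \<times> UNIV)"
      using s[OF that] by (simp add: mom_def has_sum_infsum)
    then have "(g x has_sum mom 0 x) UNIV"
      by (rule has_sum_SigmaD) (use inner[OF that] in auto)
    moreover have "((\<lambda>m. (1 / x) * (oddw m / real m)) has_sum (1 / x) * Z) UNIV"
      unfolding Z_def by (intro has_sum_cmult_right has_sum_infsum Zs)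
    ultimately have "mom 0 x \<le> (1 / x) * Z"
      by (rule has_sum_mono) (use gle[OF that] in auto)
    then show ?thesis by simp
  qed
  moreover have "Z \<ge> 0" unfolding Z_def by (intro infsum_nonneg) auto
  ultimately have "\<forall>x>0. mom 0 x \<le> (Z + 1) / x"
    by (meson divide_right_mono le_add_same_cancel1 less_imp_le order_trans zero_le_one)
  then show "\<exists>Z>0. \<forall>x>0. mom 0 x \<le> Z / x"
    using \<open>Z \<ge> 0\<close> by (intro exI[of _ "Z + 1"]) auto
qed

lemma power_le_fact_exp:
  fixes y :: real
  assumes "y \<ge> 0"
  shows "y ^ i \<le> fact i * exp y"
proof -
  have "(\<Sum>k\<in>{i}. y ^ k /\<^sub>R fact k) \<le> (\<Sum>k. y ^ k /\<^sub>R fact k)"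
    using assms by (intro sum_le_suminf summable_exp_generic) auto
  then show ?thesis by (simp add: exp_def field_simps)
qed

text \<open>Half of the exponential decay absorbs the power of the frequency, which reduces every
  moment at \<open>x\<close> to the zeroth one at \<open>x / 2\<close>.\<close>

lemma amp_frq_le:
  assumes "x > 0"
  shows "amp x p * frq p ^ i \<le> fact i * (2 / x) ^ i * amp (x / 2) p"
proof -
  have "(x / 2 * frq p) ^ i \<le> fact i * exp (x / 2 * frq p)"
    using assms by (intro power_le_fact_exp) auto
  then have "(2 / x) ^ i * (x / 2 * frq p) ^ i \<le> (2 / x) ^ i * (fact i * exp (x / 2 * frq p))"
    using assms by (intro mult_left_mono) auto
  moreover have "(2 / x) ^ i * (x / 2 * frq p) ^ i = frq p ^ i"
    using assms by (simp add: flip: power_mult_distrib)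
  ultimately have "frq p ^ i \<le> fact i * (2 / x) ^ i * exp (x / 2 * frq p)"
    by (simp add: mult_ac)
  then have "amp x p * frq p ^ i \<le> amp x p * (fact i * (2 / x) ^ i * exp (x / 2 * frq p))"
    by (intro mult_left_mono) auto
  also have "\<dots> = fact i * (2 / x) ^ i * (oddw (fst p) * (exp (- (x * frq p)) * exp (x / 2 * frq p)))"
    by (simp add: amp_def mult_ac)
  also have "exp (- (x * frq p)) * exp (x / 2 * frq p) = exp (- (x / 2 * frq p))"
    by (simp flip: exp_add)
  finally show ?thesis by (simp add: amp_def)
qed

lemma mom_has_sum:
  assumes "x > 0"
  shows "((\<lambda>p. amp x p * frq p ^ i) has_sum mom i x) UNIV"
proof -
  have "(\<lambda>p. amp x p * frq p ^ i) summable_on UNIV"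
    using assms
    by (intro summable_on_comparison_test[OF
        summable_on_cmult_right[OF summable_amp[of "x / 2"], of "fact i * (2 / x) ^ i"]] amp_frq_le) auto
  then show ?thesis unfolding mom_def by (rule has_sum_infsum)
qed

lemma mom_upper: "\<exists>C>0. \<forall>x>0. mom i x \<le> C / x ^ (i + 1)"
proof -
  obtain Z where Z: "Z > 0" "\<And>x. x > 0 \<Longrightarrow> mom 0 x \<le> Z / x"
    using mom_0_bound by auto
  have "mom i x \<le> (fact i * 2 ^ (i + 1) * Z) / x ^ (i + 1)" if x: "x > 0" for x
  proof -
    have "((\<lambda>p. fact i * (2 / x) ^ i * (amp (x / 2) p * frq p ^ 0)) has_sum
        fact i * (2 / x) ^ i * mom 0 (x / 2)) UNIV"
      using x by (intro has_sum_cmult_right mom_has_sum) auto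
    with mom_has_sum[OF x] have "mom i x \<le> fact i * (2 / x) ^ i * mom 0 (x / 2)"
      by (rule has_sum_mono) (use amp_frq_le[OF x] in auto)
    also have "\<dots> \<le> fact i * (2 / x) ^ i * (Z / (x / 2))"
      using x by (intro mult_left_mono Z) auto
    also have "\<dots> = (fact i * 2 ^ (i + 1) * Z) / x ^ (i + 1)"
      using x by (simp add: field_simps)
    finally show ?thesis .
  qed
  then show ?thesis
    using Z(1) by (intro exI[of _ "fact i * 2 ^ (i + 1) * Z"]) auto
qed

text \<open>About \<open>1 / x\<close> indices have a frequency of order \<open>1 / x\<close>, where
  the exponential is still bounded below. These alone match the order of the upper bound.\<close>

lemma mom_lower:
  assumes "0 < x" "x \<le> 1"
  shows "mom i x \<ge> 2 * exp (- 4) / x ^ (i + 1)"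
proof -
  \<comment> \<open>For \<open>j\<close> from \<open>J\<close> to \<open>2 * J - 1\<close> the
    frequency \<open>j + 1\<close> lies between \<open>1 / x\<close> and
    \<open>2 * (1 / x + 1)\<close>, so \<open>x\<close> times it is at most 4: hence
    \<open>exp (- 4)\<close>. The factor 2 is \<open>oddw 1\<close>.\<close>
  define J where "J = nat \<lceil>1 / x\<rceil>"
  have J: "1 / x \<le> real J" "real J \<le> 1 / x + 1" using assms by (auto simp: J_def)
  have J0: "J > 0" using J(1) assms by (metis divide_pos_pos gr0I not_less of_nat_0 zero_less_one)
  define F where "F = (\<lambda>j. (1::nat, j)) ` {J..<2 * J}"
  have "real J * (2 * exp (- 4) * (1 / x) ^ i) \<le> (\<Sum>p\<in>F. amp x p * frq p ^ i)"
  proof -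
    have "2 * exp (- 4) * (1 / x) ^ i \<le> amp x (1, j) * frq (1, j) ^ i" if "j \<in> {J..<2 * J}" for j
    proof (rule mult_mono)
      have "real (Suc j) \<le> 2 * real J" using that by auto
      then have "x * real (Suc j) \<le> x * (2 * (1 / x + 1))"
        using J assms by (intro mult_left_mono) auto
      also have "\<dots> \<le> 4" using assms by (simp add: field_simps)
      finally show "2 * exp (- 4) \<le> amp x (1, j)"
        by (simp add: amp_def oddw_def frq_def)
      have "1 / x \<le> frq (1, j)" using J that by (auto simp: frq_def)
      then show "(1 / x) ^ i \<le> frq (1, j) ^ i"
        using assms by (intro power_mono) auto
    qed (use assms in auto)
    then have "(\<Sum>j\<in>{J..<2 * J}. 2 * exp (- 4) * (1 / x) ^ i) \<le>
        (\<Sum>j\<in>{J..<2 * J}. amp x (1, j) * frq (1, j) ^ i)"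
      by (intro sum_mono)
    then show ?thesis unfolding F_def by (subst sum.reindex) (auto simp: inj_on_def)
  qed
  also have "\<dots> \<le> mom i x"
    by (rule finite_sum_le_has_sum[OF mom_has_sum]) (use assms in \<open>auto simp: F_def\<close>)
  finally have "real J * (2 * exp (- 4) * (1 / x) ^ i) \<le> mom i x" .
  moreover have "(1 / x) * (2 * exp (- 4) * (1 / x) ^ i) \<le> real J * (2 * exp (- 4) * (1 / x) ^ i)"
    using J assms by (intro mult_right_mono) auto
  ultimately show ?thesis by (simp add: power_one_over field_simps)
qed

text \<open>The derivative of \<open>mom 1\<close> is \<open>- mom 2\<close>, largest in modulus at
  the left end \<open>\<delta>\<close>; this suggests the Lipschitz constant, which is then verified
  term by term without differentiating a series.\<close>

lemma continuous_on_mom_1: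
  assumes "\<delta> > 0"
  shows "continuous_on {\<delta>..} (mom 1)"
proof -
  have *: "\<bar>exp (- (x * k)) - exp (- (y * k))\<bar> \<le> \<bar>x - y\<bar> * k * exp (- (\<delta> * k))"
    if "x \<in> {\<delta>..}" "y \<in> {\<delta>..}" "k \<ge> 0" for x y k :: real
    using that
  proof (induction x y rule: linorder_wlog)
    case (le x y)
    have "exp (- (x * k)) - exp (- (y * k)) = exp (- (x * k)) * (1 - exp (- ((y - x) * k)))"
      by (simp add: algebra_simps flip: exp_add)
    moreover have "0 \<le> 1 - exp (- ((y - x) * k))" using le by simp
    moreover have "1 - exp (- ((y - x) * k)) \<le> (y - x) * k"
      using exp_ge_add_one_self[of "- ((y - x) * k)"] by simp
    moreover have "exp (- (x * k)) \<le> exp (- (\<delta> * k))"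
      using le by (auto intro: mult_right_mono)
    ultimately have "\<bar>exp (- (x * k)) - exp (- (y * k))\<bar> \<le> exp (- (\<delta> * k)) * ((y - x) * k)"
      by (simp add: mult_mono)
    then show ?case using le by (simp add: mult_ac)
  qed (simp add: abs_minus_commute)
  have "(mom 2 \<delta>)-lipschitz_on {\<delta>..} (mom 1)"
  proof (rule lipschitz_onI)
    fix x y assume xy: "x \<in> {\<delta>..}" "y \<in> {\<delta>..}"
    have "((\<lambda>p. amp x p * frq p ^ 1 + - (amp y p * frq p ^ 1)) has_sum (mom 1 x + - mom 1 y)) UNIV"
      using xy assms by (intro has_sum_add has_sum_uminusI mom_has_sum) auto
    moreover have "((\<lambda>p. \<bar>x - y\<bar> * (amp \<delta> p * frq p ^ 2)) has_sum \<bar>x - y\<bar> * mom 2 \<delta>) UNIV"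
      using assms by (intro has_sum_cmult_right mom_has_sum)
    ultimately have "norm (mom 1 x + - mom 1 y) \<le> \<bar>x - y\<bar> * mom 2 \<delta>"
    proof (rule norm_infsum_le)
      fix p
      have "amp x p * frq p ^ 1 + - (amp y p * frq p ^ 1) =
          oddw (fst p) * frq p * (exp (- (x * frq p)) - exp (- (y * frq p)))"
        by (simp add: amp_def algebra_simps)
      then have "norm (amp x p * frq p ^ 1 + - (amp y p * frq p ^ 1)) =
          oddw (fst p) * frq p * \<bar>exp (- (x * frq p)) - exp (- (y * frq p))\<bar>"
        by (simp only: real_norm_def abs_mult abs_of_nonneg[OF oddw_nonneg] abs_of_nonneg[OF frq_nonneg])
      also have "\<dots> \<le> oddw (fst p) * frq p * (\<bar>x - y\<bar> * frq p * exp (- (\<delta> * frq p)))"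
        using xy by (intro mult_left_mono *) auto
      finally show "norm (amp x p * frq p ^ 1 + - (amp y p * frq p ^ 1)) \<le>
          \<bar>x - y\<bar> * (amp \<delta> p * frq p ^ 2)"
        by (simp add: amp_def power2_eq_square mult_ac)
    qed
    then show "dist (mom 1 x) (mom 1 y) \<le> mom 2 \<delta> * dist x y"
      by (simp add: dist_norm mult.commute)
  next
    show "0 \<le> mom 2 \<delta>" unfolding mom_def by (intro infsum_nonneg) auto
  qed
  then show ?thesis by (rule lipschitz_on_continuous_on)
qed

lemma saddle_points:
  obtains \<xi> :: "nat \<Rightarrow> real" where
    "\<And>n. 0 < \<xi> n" "\<And>n. \<xi> n \<le> 1 / 2" "\<forall>\<^sub>F n in sequentially. mom 1 (\<xi> n) = real n" "\<xi> \<longlonglongrightarrow> 0"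
proof -
  have ex: "\<exists>x. 0 < x \<and> x \<le> 1 / 2 \<and> mom 1 x = real n" if n: "real n \<ge> mom 1 (1 / 2)" "n \<ge> 1" for n
  proof -
    \<comment> \<open>Chosen so that the lower bound for \<open>mom 1 y\<close> equals
      \<open>2 * n\<close>: \<open>y\<close> is the left end point for the intermediate value
      theorem, \<open>1 / 2\<close> the right one.\<close>
    define y where "y = exp (- 2) / sqrt (real n)"
    have y: "0 < y" "y \<le> 1 / 2"
    proof -
      have "exp (2 :: real) \<ge> 1 + 2" by (rule exp_ge_add_one_self)
      then have "exp (- 2) \<le> (1 / 2 :: real)" by (simp add: exp_minus field_simps)
      moreover have "y \<le> exp (- 2)" unfolding y_def using n by (simp add: divide_le_eq)
      ultimately show "y \<le> 1 / 2" by linarith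
    qed (use n in \<open>simp add: y_def\<close>)
    have "y ^ (1 + 1) = exp (- 4) / real n"
      using n by (simp add: y_def power_divide flip: exp_of_nat_mult exp_add)
    then have "2 * exp (- 4) / y ^ (1 + 1) = 2 * real n"
      by simp
    then have "real n \<le> 2 * exp (- 4) / y ^ (1 + 1)"
      by linarith
    also have "\<dots> \<le> mom 1 y" using y by (intro mom_lower) auto
    finally have "\<exists>x\<ge>y. x \<le> 1 / 2 \<and> mom 1 x = real n"
      using y n by (intro IVT2' continuous_on_subset[OF continuous_on_mom_1[OF y(1)]]) auto
    then show ?thesis using y by (meson less_le_trans)
  qed
  \<comment> \<open>The default \<open>1 / 2\<close> for small \<open>n\<close> makes
    \<open>0 < \<xi> n \<le> 1 / 2\<close> hold for all \<open>n\<close>. The upper bound will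
    ensure exp (- x) \<ge> 1/2 in the decay estimate.\<close>
  define \<xi> where "\<xi> n = (if real n \<ge> mom 1 (1 / 2) \<and> n \<ge> 1
    then SOME x. 0 < x \<and> x \<le> 1 / 2 \<and> mom 1 x = real n else 1 / 2)" for n
  have \<xi>: "0 < \<xi> n" "\<xi> n \<le> 1 / 2" "real n \<ge> mom 1 (1 / 2) \<Longrightarrow> n \<ge> 1 \<Longrightarrow> mom 1 (\<xi> n) = real n" for n
    using someI_ex[OF ex[of n]] by (auto simp: \<xi>_def)
  have ev: "\<forall>\<^sub>F n in sequentially. mom 1 (\<xi> n) = real n"
    using eventually_ge_at_top[of 1] eventually_ge_at_top[of "nat \<lceil>mom 1 (1 / 2)\<rceil>"]
    by eventually_elim (rule \<xi>, linarith+)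
  obtain C where C: "C > 0" "\<And>x. x > 0 \<Longrightarrow> mom 1 x \<le> C / x ^ (1 + 1)"
    using mom_upper[of 1] by auto
  have "\<xi> \<longlonglongrightarrow> 0"
  proof (rule tendsto_sandwich[OF _ _ tendsto_const])
    show "\<forall>\<^sub>F n in sequentially. 0 \<le> \<xi> n" using \<xi>(1) by (auto intro: always_eventually less_imp_le)
    show "\<forall>\<^sub>F n in sequentially. \<xi> n \<le> sqrt (C / real n)"
      using ev eventually_gt_at_top[of 0]
    proof eventually_elim
      case (elim n)
      have "real n \<le> C / \<xi> n ^ 2" using C(2)[OF \<xi>(1)[of n]] elim by (simp add: numeral_2_eq_2)
      then have "\<xi> n ^ 2 \<le> C / real n" using \<xi>(1)[of n] elim by (simp add: field_simps)
      then show ?case by (rule real_le_rsqrt)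
    qed
    show "(\<lambda>n. sqrt (C / real n)) \<longlonglongrightarrow> 0"
      by (intro tendsto_eq_intros real_tendsto_divide_at_top filterlim_real_sequentially) auto
  qed
  then show ?thesis using that[of \<xi>] \<xi>(1,2) ev by blast
qed

text \<open>A logarithm of P at the point of modulus exp (- x) and argument \<phi>. The double
  series fixes it without any choice of branch.\<close>

definition logchar :: "real \<Rightarrow> real \<Rightarrow> complex" where
  "logchar x \<phi> = (\<Sum>\<^sub>\<infinity>p. complex_of_real (amp x p) * cis (frq p * \<phi>))"

lemma logchar_has_sum:
  assumes "x > 0"
  shows "((\<lambda>p. complex_of_real (amp x p) * cis (frq p * \<phi>)) has_sum logchar x \<phi>) UNIV"
proof -
  have "(\<lambda>p. norm (complex_of_real (amp x p) * cis (frq p * \<phi>))) summable_on UNIV"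
    using summable_amp[OF assms] by (simp add: norm_mult)
  then have "(\<lambda>p. complex_of_real (amp x p) * cis (frq p * \<phi>)) summable_on UNIV"
    by (rule abs_summable_summable)
  then show ?thesis unfolding logchar_def by (rule has_sum_infsum)
qed

lemma of_real_mom_has_sum:
  assumes "x > 0"
  shows "((\<lambda>p. complex_of_real (amp x p * frq p ^ i)) has_sum complex_of_real (mom i x)) UNIV"
  using mom_has_sum[OF assms] by (rule has_sum_of_real)

text \<open>Taylor expansion of \<open>cis\<close> in each term; as the amplitudes are nonnegative,
  the remainders add up to the third moment.\<close>

lemma logchar_expansion:
  assumes "x > 0"
  shows "norm (logchar x \<phi> - (mom 0 x + \<i> * \<phi> * mom 1 x - \<phi>\<^sup>2 / 2 * mom 2 x))
           \<le> \<bar>\<phi>\<bar> ^ 3 / 6 * mom 3 x"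
proof -
  define g where "g p = complex_of_real (amp x p) * cis (frq p * \<phi>) +
     - (of_real (amp x p * frq p ^ 0) + ((\<i> * of_real \<phi>) * of_real (amp x p * frq p ^ 1) +
        of_real (- (\<phi>\<^sup>2 / 2)) * of_real (amp x p * frq p ^ 2)))" for p
  have "(g has_sum (logchar x \<phi> +
      - (of_real (mom 0 x) + ((\<i> * of_real \<phi>) * of_real (mom 1 x) + of_real (- (\<phi>\<^sup>2 / 2)) * of_real (mom 2 x))))) UNIV"
    unfolding g_def
    by (intro has_sum_add has_sum_uminusI has_sum_cmult_right of_real_mom_has_sum[OF assms]
        logchar_has_sum[OF assms])
  moreover have "((\<lambda>p. \<bar>\<phi>\<bar> ^ 3 / 6 * (amp x p * frq p ^ 3)) has_sum \<bar>\<phi>\<bar> ^ 3 / 6 * mom 3 x) UNIV"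
    by (intro has_sum_cmult_right mom_has_sum[OF assms])
  ultimately have "norm (logchar x \<phi> +
      - (of_real (mom 0 x) + ((\<i> * of_real \<phi>) * of_real (mom 1 x) + of_real (- (\<phi>\<^sup>2 / 2)) * of_real (mom 2 x))))
      \<le> \<bar>\<phi>\<bar> ^ 3 / 6 * mom 3 x"
  proof (rule norm_infsum_le)
    fix p
    define y where "y = frq p * \<phi>"
    have "norm (cis y - (1 + \<i> * y - y\<^sup>2 / 2)) \<le> \<bar>y\<bar> ^ 3 / 6"
      using iexp_approx1[of y 2]
      by (simp add: cis_conv_exp numeral_2_eq_2 fact_numeral power2_eq_square algebra_simps
          eval_nat_numeral)
    then have "amp x p * norm (cis y - (1 + \<i> * y - y\<^sup>2 / 2)) \<le> amp x p * (\<bar>y\<bar> ^ 3 / 6)"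
      by (intro mult_left_mono) auto
    moreover have "g p = of_real (amp x p) * (cis y - (1 + \<i> * y - y\<^sup>2 / 2))"
      by (simp add: g_def y_def algebra_simps power2_eq_square)
    ultimately show "norm (g p) \<le> \<bar>\<phi>\<bar> ^ 3 / 6 * (amp x p * frq p ^ 3)"
      by (simp add: norm_mult y_def abs_mult power_mult_distrib mult_ac)
  qed
  then show ?thesis by (simp add: algebra_simps)
qed

section \<open>Decay away from the positive real axis\<close>

lemma abs_cos_minus_quadratic_le: "\<bar>cos y - (1 - y\<^sup>2 / 2)\<bar> \<le> y ^ 4 / 24" for y :: real
proof -
  have "norm (cis y - (\<Sum>k\<le>3. (\<i> * y) ^ k / fact k)) \<le> \<bar>y\<bar> ^ 4 / fact 4"
    using iexp_approx1[of y 3] by (simp add: cis_conv_exp)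
  then have "\<bar>Re (cis y - (\<Sum>k\<le>3. (\<i> * y) ^ k / fact k))\<bar> \<le> \<bar>y\<bar> ^ 4 / fact 4"
    using abs_Re_le_cmod order_trans by blast
  moreover have "Re (cis y - (\<Sum>k\<le>3. (\<i> * y) ^ k / fact k)) = cos y - (1 - y\<^sup>2 / 2)"
    by (simp add: eval_nat_numeral atMost_Suc power2_eq_square)
  ultimately have "\<bar>cos y - (1 - y\<^sup>2 / 2)\<bar> \<le> \<bar>y\<bar> ^ 4 / fact 4" by (simp only:)
  then show ?thesis by (simp add: fact_numeral)
qed

text \<open>The constant 1/8 is not optimal but permits crude numerics on the whole interval: Taylor
  expansion up to 2, and beyond it monotonicity of the cosine, where \<open>3.2\<^sup>2 / 8\<close>
  is still below \<open>4 / 3\<close>.\<close>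

lemma cos_le_quadratic:
  assumes "\<bar>\<phi>\<bar> \<le> pi"
  shows "\<phi>\<^sup>2 / 8 \<le> 1 - cos \<phi>"
proof -
  have small: "y\<^sup>2 / 3 \<le> 1 - cos y" if "\<bar>y\<bar> \<le> 2" for y :: real
  proof -
    have "\<bar>cos y - (1 - y\<^sup>2 / 2)\<bar> \<le> y ^ 4 / 24"
      by (rule abs_cos_minus_quadratic_le)
    moreover have "y ^ 4 / 24 \<le> y\<^sup>2 / 6"
    proof -
      have "\<bar>y\<bar> ^ 2 \<le> 2 ^ 2" using that by (intro power_mono) auto
      then have "y\<^sup>2 * y\<^sup>2 \<le> 4 * y\<^sup>2" by (intro mult_right_mono) auto
      then show ?thesis by (simp add: fact_numeral power4_eq_xxxx power2_eq_square)
    qed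
    ultimately show ?thesis by linarith
  qed
  show ?thesis
  proof (cases "\<bar>\<phi>\<bar> \<le> 2")
    case True
    then show ?thesis using small[of \<phi>] zero_le_power2[of \<phi>] by linarith
  next
    case False
    have "cos \<phi> = cos \<bar>\<phi>\<bar>" by simp
    also have "\<dots> \<le> cos 2"
      using False assms by (intro cos_monotone_0_pi_le) auto
    also have "\<dots> \<le> - (1 / 3)" using small[of 2] by simp
    finally have "4 / 3 \<le> 1 - cos \<phi>" by simp
    moreover have "\<phi>\<^sup>2 \<le> 3.2\<^sup>2"
    proof -
      have "\<bar>\<phi>\<bar> ^ 2 \<le> 3.2\<^sup>2"
        using assms pi_approx by (intro power_mono) auto
      then show ?thesis by simp
    qed
    ultimately show ?thesis by (simp add: power2_eq_square)
  qed
qed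

text \<open>Up to the factor \<open>oddw 1 = 2\<close>, this is the part of
  \<open>mom 0 x - Re (logchar x \<phi>)\<close> with first index 1, for r = exp (- x). It is the
  real part of a difference of two geometric series; the inner bracket of the denominator is the
  squared distance from 1 to \<open>r * cis \<phi>\<close>.\<close>

lemma sum_one_minus_cos:
  assumes "0 < r" "r < 1"
  shows "(\<lambda>j. r ^ Suc j * (1 - cos (real (Suc j) * \<phi>))) sums
    (r * (1 + r) * (1 - cos \<phi>) / ((1 - r) * ((1 - r)\<^sup>2 + 2 * r * (1 - cos \<phi>))))"
proof -
  define q where "q = complex_of_real r * cis \<phi>"
  have nq: "norm q < 1" using assms by (simp add: q_def norm_mult)
  have q1: "1 - q \<noteq> 0" using nq by auto
  have "(\<lambda>j. complex_of_real r * complex_of_real r ^ j) sums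
      (complex_of_real r * (1 / (1 - complex_of_real r)))"
    using assms by (intro sums_mult geometric_sums) auto
  moreover have "(\<lambda>j. q * q ^ j) sums (q * (1 / (1 - q)))"
    using nq by (intro sums_mult geometric_sums)
  ultimately have "(\<lambda>j. Re (complex_of_real r * complex_of_real r ^ j - q * q ^ j)) sums
      Re (complex_of_real r * (1 / (1 - complex_of_real r)) - q * (1 / (1 - q)))"
    by (intro sums_Re sums_diff)
  moreover have "Re (complex_of_real r * complex_of_real r ^ j - q * q ^ j) =
      r ^ Suc j * (1 - cos (real (Suc j) * \<phi>))" for j
  proof -
    have "complex_of_real r * complex_of_real r ^ j = complex_of_real (r ^ Suc j)" by simp
    moreover have "q ^ Suc j = complex_of_real (r ^ Suc j) * cis (real (Suc j) * \<phi>)"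
      by (simp only: q_def power_mult_distrib Complex.DeMoivre of_real_power)
    moreover have "Re (complex_of_real A - complex_of_real A * cis t) = A * (1 - cos t)" for A t
      by (simp add: algebra_simps)
    ultimately show ?thesis unfolding power_Suc[of q, symmetric] by (simp only:)
  qed
  moreover have "Re (complex_of_real r * (1 / (1 - complex_of_real r)) - q * (1 / (1 - q))) =
      r * (1 + r) * (1 - cos \<phi>) / ((1 - r) * ((1 - r)\<^sup>2 + 2 * r * (1 - cos \<phi>)))"
  proof -
    have D: "(norm (1 - q))\<^sup>2 = (1 - r)\<^sup>2 + 2 * r * (1 - cos \<phi>)"
    proof -
      have "(norm (1 - q))\<^sup>2 = (1 - r * cos \<phi>)\<^sup>2 + (r * sin \<phi>)\<^sup>2"
        by (simp add: cmod_power2 q_def)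
      also have "\<dots> = 1 - 2 * r * cos \<phi> + r\<^sup>2 * ((sin \<phi>)\<^sup>2 + (cos \<phi>)\<^sup>2)"
        by algebra
      finally show ?thesis by (simp add: power2_eq_square algebra_simps)
    qed
    define E where "E = (1 - r)\<^sup>2 + 2 * r * (1 - cos \<phi>)"
    have E: "E > 0" unfolding E_def D[symmetric] using q1 by simp
    have e1: "Re (1 / (1 - q)) = (1 - r * cos \<phi>) / E"
      unfolding Re_divide' D E_def by (simp add: q_def)
    have e2: "q * (1 / (1 - q)) = 1 / (1 - q) - 1"
      using q1 by (simp add: field_simps)
    have e3: "Re (complex_of_real r * (1 / (1 - complex_of_real r))) = r / (1 - r)"
    proof -
      have "complex_of_real r * (1 / (1 - complex_of_real r)) = complex_of_real (r / (1 - r))"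
        by simp
      then show ?thesis by (simp only: Re_complex_of_real)
    qed
    have "Re (complex_of_real r * (1 / (1 - complex_of_real r)) - q * (1 / (1 - q))) =
      r / (1 - r) - ((1 - r * cos \<phi>) / E - 1)"
      unfolding e2 minus_complex.sel e1 e3 by simp
    also have "\<dots> = (E - (1 - r) * (1 - r * cos \<phi>)) / ((1 - r) * E)"
      using assms E by (simp add: field_simps)
    also have "E - (1 - r) * (1 - r * cos \<phi>) = r * (1 + r) * (1 - cos \<phi>)"
      by (simp add: E_def power2_eq_square algebra_simps)
    finally show ?thesis unfolding E_def .
  qed
  ultimately show ?thesis by simp
qed

text \<open>The difference consists of terms \<open>amp x p * (1 - cos (frq p * \<phi>))\<close> of
  one sign, so those with first index 1 may be kept alone. The exponent obtained has order
  \<open>\<phi>\<^sup>2 / x ^ 3\<close> while \<bar>\<phi>\<bar> \<le> x and order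
  \<open>1 / x\<close> beyond: one estimate covers the Gaussian range and the rest of the
  circle.\<close>

lemma Re_logchar_le:
  assumes "0 < x" "x \<le> 1 / 2" "\<bar>\<phi>\<bar> \<le> pi"
  shows "Re (logchar x \<phi>) - mom 0 x \<le> - (\<phi>\<^sup>2 / (8 * x * (x\<^sup>2 + \<phi>\<^sup>2)))"
proof -
  define r where "r = exp (- x)"
  have r: "0 < r" "r < 1" "1 / 2 \<le> r" "1 - r \<le> x"
    using assms exp_ge_add_one_self[of "- x"] unfolding r_def by auto
  define v where "v = 1 - cos \<phi>"
  have v: "0 \<le> \<phi>\<^sup>2 / 8" "\<phi>\<^sup>2 / 8 \<le> v" unfolding v_def using cos_le_quadratic[OF assms(3)] by auto
  define s where "s = r * (1 + r) * v / ((1 - r) * ((1 - r)\<^sup>2 + 2 * r * v))"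
  have s: "((\<lambda>j. r ^ Suc j * (1 - cos (real (Suc j) * \<phi>))) has_sum s) UNIV"
    unfolding s_def v_def using r
    by (intro sums_nonneg_imp_has_sum[OF sum_one_minus_cos]) auto
  have "((\<lambda>p. amp x p * frq p ^ 0 + - Re (complex_of_real (amp x p) * cis (frq p * \<phi>))) has_sum
      mom 0 x + - Re (logchar x \<phi>)) UNIV"
    using assms by (intro has_sum_add has_sum_uminusI has_sum_Re mom_has_sum logchar_has_sum)
  then have tot: "((\<lambda>p. amp x p * (1 - cos (frq p * \<phi>))) has_sum (mom 0 x - Re (logchar x \<phi>))) UNIV"
    by (simp add: algebra_simps)
  have "((\<lambda>j. 2 * (r ^ Suc j * (1 - cos (real (Suc j) * \<phi>)))) has_sum 2 * s) UNIV"
    by (intro has_sum_cmult_right s)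
  also have "(\<lambda>j. 2 * (r ^ Suc j * (1 - cos (real (Suc j) * \<phi>)))) =
      (\<lambda>p. amp x p * (1 - cos (frq p * \<phi>))) \<circ> (\<lambda>j. (1, j))"
  proof
    fix j
    have "r ^ Suc j = exp (- (x * real (Suc j)))"
      unfolding r_def exp_of_nat_mult[symmetric] by (simp add: algebra_simps)
    then show "2 * (r ^ Suc j * (1 - cos (real (Suc j) * \<phi>))) =
        ((\<lambda>p. amp x p * (1 - cos (frq p * \<phi>))) \<circ> (\<lambda>j. (1, j))) j"
      by (simp add: amp_def oddw_def frq_def del: power_Suc)
  qed
  finally have "((\<lambda>p. amp x p * (1 - cos (frq p * \<phi>))) has_sum 2 * s) (range (\<lambda>j. (1 :: nat, j)))"
    by (subst has_sum_reindex) (simp_all add: inj_on_def o_def)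
  from this tot have "2 * s \<le> mom 0 x - Re (logchar x \<phi>)"
    by (rule has_sum_mono_neutral) (auto intro!: mult_nonneg_nonneg)
  moreover have "\<phi>\<^sup>2 / (8 * x * (x\<^sup>2 + \<phi>\<^sup>2)) \<le> 2 * s"
  proof (cases "\<phi> = 0")
    case True
    then show ?thesis by (simp add: s_def v_def)
  next
    case False
    \<comment> \<open>As a function of \<open>t\<close>,
      \<open>t / (x * (x\<^sup>2 + 8 * t))\<close> increases, so \<open>v\<close> may be replaced by
      its lower bound \<open>\<phi>\<^sup>2 / 8\<close>, which produces
      \<open>x\<^sup>2 + \<phi>\<^sup>2\<close> in the denominator.\<close>
    define h where "h = \<phi>\<^sup>2 / 8"
    have h: "h > 0" "h \<le> v" using False v by (auto simp: h_def)
    have vp: "v > 0" using h by simp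
    have "\<phi>\<^sup>2 / (8 * x * (x\<^sup>2 + \<phi>\<^sup>2)) = h / (x * (x\<^sup>2 + 8 * h))"
      by (simp add: h_def field_simps)
    also have "\<dots> \<le> v / (x * (x\<^sup>2 + 8 * v))"
    proof -
      have "h * (x * (x\<^sup>2 + 8 * v)) \<le> v * (x * (x\<^sup>2 + 8 * h))"
        using mult_right_mono[OF h(2), of "x * x\<^sup>2"] assms by (simp add: algebra_simps)
      moreover have "0 < x * (x\<^sup>2 + 8 * v)" "0 < x * (x\<^sup>2 + 8 * h)"
        using assms vp h by (auto intro!: mult_pos_pos add_pos_pos)
      moreover have "a / b \<le> c / d" if "a * d \<le> c * b" "0 < d" "0 < b" for a b c d :: real
        using that by (simp add: field_simps)
      ultimately show ?thesis by blast
    qed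
    also have "\<dots> \<le> v / ((1 - r) * ((1 - r)\<^sup>2 + 2 * r * v))"
    proof (rule divide_left_mono)
      have "2 * r * v \<le> 8 * v" using r vp by (intro mult_right_mono) auto
      moreover have "(1 - r)\<^sup>2 \<le> x\<^sup>2" using r by (intro power_mono) auto
      ultimately show "(1 - r) * ((1 - r)\<^sup>2 + 2 * r * v) \<le> x * (x\<^sup>2 + 8 * v)"
        using r vp assms by (intro mult_mono add_mono) auto
      show "0 < x * (x\<^sup>2 + 8 * v) * ((1 - r) * ((1 - r)\<^sup>2 + 2 * r * v))"
        using r vp assms by (intro mult_pos_pos add_pos_pos) auto
    qed (use vp in auto)
    also have "\<dots> \<le> (2 * r * (1 + r)) * (v / ((1 - r) * ((1 - r)\<^sup>2 + 2 * r * v)))"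
    proof -
      have "1 * 1 \<le> (2 * r) * (1 + r)" using r by (intro mult_mono) auto
      then have "1 \<le> 2 * r * (1 + r)" by simp
      moreover have "0 \<le> v / ((1 - r) * ((1 - r)\<^sup>2 + 2 * r * v))"
        using r vp by (intro divide_nonneg_nonneg mult_nonneg_nonneg add_nonneg_nonneg) auto
      ultimately have "1 * (v / ((1 - r) * ((1 - r)\<^sup>2 + 2 * r * v))) \<le>
          (2 * r * (1 + r)) * (v / ((1 - r) * ((1 - r)\<^sup>2 + 2 * r * v)))"
        by (rule mult_right_mono)
      then show ?thesis by (simp only: mult_1_left)
    qed
    also have "\<dots> = 2 * s" by (simp add: s_def)
    finally show ?thesis .
  qed
  ultimately show ?thesis by linarith
qed

text \<open>The expansion of Ln (1 + z) - Ln (1 - z) has the coefficients \<open>oddw\<close>, and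
  absolute convergence allows the summations to be interchanged. A sum of principal logarithms need
  not be principal, but the exponential removes the ambiguity.\<close>

lemma overprod_tendsto:
  assumes "x > 0"
  defines "q \<equiv> \<lambda>\<phi>. complex_of_real (exp (- x)) * cis \<phi>"
  shows "(\<lambda>N. \<Prod>j\<in>{1..N}. (1 + q \<phi> ^ j) / (1 - q \<phi> ^ j)) \<longlonglongrightarrow> exp (logchar x \<phi>)"
proof -
  define z where "z j = q \<phi> ^ Suc j" for j
  have nz: "norm (z j) < 1" for j
    using assms by (simp add: z_def q_def norm_mult norm_power power_Suc_less_one mult_less_cancel_left1 power_le_one mult_le_one  flip: power_Suc)
  have inner: "((\<lambda>m. complex_of_real (amp x (m, j)) * cis (frq (m, j) * \<phi>)) has_sum
      (Ln (1 + z j) - Ln (1 - z j))) UNIV" for j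
  proof -
    have t: "complex_of_real (amp x (m, j)) * cis (frq (m, j) * \<phi>) = of_real (oddw m) * z j ^ m" for m
    proof -
      have "z j ^ m = q \<phi> ^ (m * Suc j)"
        by (simp only: z_def power_mult[symmetric] mult.commute)
      also have "\<dots> = complex_of_real (exp (- x) ^ (m * Suc j)) * cis (real (m * Suc j) * \<phi>)"
        unfolding q_def power_mult_distrib Complex.DeMoivre by simp
      also have "exp (- x) ^ (m * Suc j) = exp (- (x * frq (m, j)))"
        unfolding exp_of_nat_mult[symmetric] by (simp add: frq_def algebra_simps)
      finally show ?thesis by (simp add: amp_def frq_def)
    qed
    have "(\<lambda>m. - ((- z j) ^ m) / of_nat m - (- ((- (- z j)) ^ m) / of_nat m)) sums
        (Ln (1 + z j) - Ln (1 + (- z j)))"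
      by (intro sums_diff Ln_series') (use nz in auto)
    also have "(\<lambda>m. - ((- z j) ^ m) / of_nat m - (- ((- (- z j)) ^ m) / of_nat m)) =
        (\<lambda>m. of_real (oddw m) * z j ^ m)"
      by (auto simp: fun_eq_iff oddw_def power_minus_odd diff_divide_distrib)
    finally have "(\<lambda>m. of_real (oddw m) * z j ^ m) sums (Ln (1 + z j) - Ln (1 - z j))"
      by simp
    moreover have "summable (\<lambda>m. norm (of_real (oddw m) * z j ^ m))"
    proof (rule summable_comparison_test')
      show "summable (\<lambda>m. 2 * norm (z j) ^ m)"
        using nz by (intro summable_mult summable_geometric) auto
      show "norm (norm (of_real (oddw m) * z j ^ m)) \<le> 2 * norm (z j) ^ m" for m
      proof -
        have "oddw m \<le> 2" by (auto simp: oddw_def field_simps elim!: oddE)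
        then show ?thesis by (simp add: norm_mult norm_power mult_right_mono)
      qed
    qed
    ultimately show ?thesis unfolding t by (rule norm_summable_imp_has_sum[rotated])
  qed
  have "((\<lambda>(j, m). complex_of_real (amp x (m, j)) * cis (frq (m, j) * \<phi>)) has_sum logchar x \<phi>)
      (UNIV \<times> UNIV)"
  proof -
    have "((\<lambda>p. complex_of_real (amp x p) * cis (frq p * \<phi>)) has_sum logchar x \<phi>) (UNIV \<times> UNIV)"
      using logchar_has_sum[OF assms(1)] by simp
    from has_sum_swap[THEN iffD1, OF this] show ?thesis by simp
  qed
  then have "((\<lambda>j. Ln (1 + z j) - Ln (1 - z j)) has_sum logchar x \<phi>) UNIV"
    by (rule has_sum_SigmaD) (use inner in auto)
  then have "(\<lambda>j. Ln (1 + z j) - Ln (1 - z j)) sums logchar x \<phi>"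
    by (rule has_sum_imp_sums)
  then have "(\<lambda>N. exp (\<Sum>j<N. Ln (1 + z j) - Ln (1 - z j))) \<longlonglongrightarrow> exp (logchar x \<phi>)"
    unfolding sums_def by (intro tendsto_exp)
  moreover have "exp (\<Sum>j<N. Ln (1 + z j) - Ln (1 - z j)) = (\<Prod>j\<in>{1..N}. (1 + q \<phi> ^ j) / (1 - q \<phi> ^ j))" for N
  proof -
    have "1 + z j \<noteq> 0" "1 - z j \<noteq> 0" for j
      using nz[of j] by (auto simp: add_eq_0_iff)
    then have "exp (\<Sum>j<N. Ln (1 + z j) - Ln (1 - z j)) = (\<Prod>j<N. (1 + z j) / (1 - z j))"
      by (simp add: exp_sum exp_diff)
    also have "\<dots> = (\<Prod>j\<in>{1..N}. (1 + q \<phi> ^ j) / (1 - q \<phi> ^ j))"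
      unfolding z_def by (rule prod.reindex_bij_witness[of _ "\<lambda>j. j - 1" Suc]) auto
    finally show ?thesis .
  qed
  ultimately show ?thesis by simp
qed

section \<open>Counting overpartitions by a contour integral\<close>

lemma integral_cis_int:
  "(LINT \<phi>|lborel. indicator {- pi..pi} \<phi> *\<^sub>R cis (real_of_int a * \<phi>)) = (if a = 0 then 2 * pi else 0)"
proof (cases "a = 0")
  case True
  have "(LINT \<phi>|lborel. indicator {- pi..pi} \<phi> *\<^sub>R (1 :: complex)) = of_real (2 * pi)"
    by (rule has_bochner_integral_integral_eq, rule has_bochner_integral_cong[THEN iffD1, OF refl refl _
          has_bochner_integral_indicator[of "{- pi..pi}" lborel "1 :: complex"]])
       (auto simp: scaleR_conv_of_real)
  then show ?thesis using True by simp
next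
  case False
  define G where "G z = exp (\<i> * of_int a * z) / (\<i> * of_int a)" for z :: complex
  have int: "(LINT \<phi>|lborel. indicator {- pi..pi} \<phi> *\<^sub>R cis (real_of_int a * \<phi>)) =
      G (of_real pi) - G (of_real (- pi))"
  proof (rule integral_FTC_atLeastAtMost)
    show "((\<lambda>x. G (complex_of_real x)) has_vector_derivative cis (real_of_int a * x))
        (at x within {- pi..pi})" for x
    proof (rule has_vector_derivative_real_field)
      show "(G has_field_derivative cis (real_of_int a * x)) (at (complex_of_real x))"
        unfolding G_def by (rule derivative_eq_intros refl | use False in \<open>simp add: cis_conv_exp mult_ac\<close>)+
    qed
    show "continuous_on {- pi..pi} (\<lambda>\<phi>. cis (real_of_int a * \<phi>))"
      by (intro continuous_intros)
  qed simp
  have "exp (\<i> * of_int a * of_real pi) = exp (\<i> * of_int a * of_real (- pi))"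
  proof -
    have "sin (real_of_int a * pi) = 0" using sin_zero_iff_int2 by blast
    then have "cis (real_of_int a * pi) = cis (- (real_of_int a * pi))"
      by (simp add: complex_eq_iff)
    then show ?thesis by (simp add: cis_conv_exp mult_ac)
  qed
  then have "G (of_real pi) - G (of_real (- pi)) = 0" by (simp add: G_def)
  with int show ?thesis using False by simp
qed

text \<open>Absolute convergence permits termwise integration over the circle of radius
  \<open>r\<close>, and orthogonality leaves the \<open>n\<close>-th term.\<close>

lemma fps_coefficient_integral:
  fixes F :: "complex fps"
  assumes "fps_conv_radius F \<ge> 1" "0 < r" "r < 1"
  shows "(LINT \<phi>|lborel. indicator {- pi..pi} \<phi> *\<^sub>R
      (eval_fps F (of_real r * cis \<phi>) * cis (- (real n * \<phi>)))) = 2 * pi * fps_nth F n * of_real r ^ n"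
proof -
  define f where "f k \<phi> = indicator {- pi..pi} \<phi> *\<^sub>R
      (fps_nth F k * of_real r ^ k * cis (real_of_int (int k - int n) * \<phi>))" for k \<phi>
  have int1: "integrable lborel (\<lambda>\<phi>. indicator {- pi..pi} \<phi> *\<^sub>R cis (real_of_int a * \<phi>))" for a
    by (intro borel_integrable_compact continuous_intros) auto
  have f_eq: "f k = (\<lambda>\<phi>. (fps_nth F k * of_real r ^ k) *
      (indicator {- pi..pi} \<phi> *\<^sub>R cis (real_of_int (int k - int n) * \<phi>)))" for k
    by (auto simp: f_def fun_eq_iff)
  have int: "integrable lborel (f k)" for k
    unfolding f_eq by (intro integrable_mult_right int1)
  have sm: "summable (\<lambda>k. norm (fps_nth F k * of_real r ^ k))"
    by (rule abs_summable_in_conv_radius)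
       (use assms in \<open>auto simp: fps_conv_radius_def[symmetric] intro: less_le_trans[where y = 1]\<close>)
  have nf: "norm (f k \<phi>) = norm (fps_nth F k * of_real r ^ k) * indicator {- pi..pi} \<phi>" for k \<phi>
    by (simp add: f_def norm_mult)
  have "(\<lambda>k. integral\<^sup>L lborel (f k)) sums (LINT \<phi>|lborel. (\<Sum>k. f k \<phi>))"
  proof (rule sums_integral[OF int])
    show "AE \<phi> in lborel. summable (\<lambda>k. norm (f k \<phi>))"
      unfolding nf using sm by (intro AE_I2 summable_mult2)
    show "summable (\<lambda>k. LINT \<phi>|lborel. norm (f k \<phi>))"
      unfolding nf using sm by (simp add: summable_mult2)
  qed
  moreover have "(\<Sum>k. f k \<phi>) = indicator {- pi..pi} \<phi> *\<^sub>R
      (eval_fps F (of_real r * cis \<phi>) * cis (- (real n * \<phi>)))" for \<phi>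
  proof (rule sums_unique[symmetric])
    have "(\<lambda>k. fps_nth F k * (of_real r * cis \<phi>) ^ k) sums eval_fps F (of_real r * cis \<phi>)"
      using assms by (intro sums_eval_fps) (auto simp: norm_mult intro: less_le_trans[where y = 1])
    then have "(\<lambda>k. indicator {- pi..pi} \<phi> *\<^sub>R
        (fps_nth F k * (of_real r * cis \<phi>) ^ k * cis (- (real n * \<phi>)))) sums
        (indicator {- pi..pi} \<phi> *\<^sub>R (eval_fps F (of_real r * cis \<phi>) * cis (- (real n * \<phi>))))"
      by (intro sums_scaleR_right sums_mult2)
    moreover have "indicator {- pi..pi} \<phi> *\<^sub>R
        (fps_nth F k * (of_real r * cis \<phi>) ^ k * cis (- (real n * \<phi>))) = f k \<phi>" for k
    proof -
      have "cis \<phi> ^ k * cis (- (real n * \<phi>)) = cis (real_of_int (int k - int n) * \<phi>)"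
        by (simp add: Complex.DeMoivre cis_mult algebra_simps)
      then show ?thesis by (simp add: f_def power_mult_distrib mult.assoc)
    qed
    ultimately show "(\<lambda>k. f k \<phi>) sums (indicator {- pi..pi} \<phi> *\<^sub>R
        (eval_fps F (of_real r * cis \<phi>) * cis (- (real n * \<phi>))))" by simp
  qed
  moreover have "integral\<^sup>L lborel (f k) = (if k = n then 2 * pi * fps_nth F n * of_real r ^ n else 0)" for k
    unfolding f_eq integral_mult_right_zero integral_cis_int by auto
  ultimately show ?thesis
    using sums_unique2[OF _ sums_single[of n "\<lambda>_. 2 * pi * fps_nth F n * of_real r ^ n"]] by simp
qed

lemma overprod_le_exp_mom:
  assumes "x > 0"
  shows "overprod N (exp (- x)) \<le> exp (mom 0 x)"
proof (rule incseq_le)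
  define r where "r = exp (- x)"
  have r: "0 < r" "r < 1" using assms by (auto simp: r_def)
  have pos: "0 < 1 - r ^ j" if "j \<ge> 1" for j
    using that r by (simp add: power_less_one_iff)
  have ge1: "1 \<le> (1 + r ^ j) / (1 - r ^ j)" if "j \<ge> 1" for j
    using pos[OF that] r by (simp add: le_divide_eq)
  have nn: "0 \<le> overprod N r" for N
    unfolding overprod_def by (intro prod_nonneg) (use ge1 order_trans[OF zero_le_one] in auto)
  show "incseq (\<lambda>N. overprod N (exp (- x)))"
  proof (rule incseq_SucI)
    fix N
    have "overprod N r * 1 \<le> overprod N r * ((1 + r ^ Suc N) / (1 - r ^ Suc N))"
      by (intro mult_left_mono ge1 nn) simp
    then show "overprod N (exp (- x)) \<le> overprod (Suc N) (exp (- x))"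
      by (simp add: overprod_def r_def del: power_Suc)
  qed
  have "logchar x 0 = complex_of_real (mom 0 x)"
    using has_sum_unique[OF logchar_has_sum[OF assms, of 0]] of_real_mom_has_sum[OF assms, of 0] by simp
  then have "(\<lambda>N. complex_of_real (overprod N (exp (- x)))) \<longlonglongrightarrow> complex_of_real (exp (mom 0 x))"
    using overprod_tendsto[OF assms, of 0] by (simp add: overprod_def exp_of_real)
  then show "(\<lambda>N. overprod N (exp (- x))) \<longlonglongrightarrow> exp (mom 0 x)"
    by (simp only: tendsto_of_real_iff)
qed

lemma continuous_on_circle_overprod:
  assumes "0 < r" "r < 1"
  shows "continuous_on UNIV (\<lambda>\<phi>. \<Prod>j\<in>{1..N}. (1 + (complex_of_real r * cis \<phi>) ^ j) /
           (1 - (complex_of_real r * cis \<phi>) ^ j))"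
proof -
  define q where "q \<phi> = complex_of_real r * cis \<phi>" for \<phi>
  have nq: "norm (q \<phi>) = r" for \<phi> using assms by (simp add: q_def norm_mult)
  have ne: "1 - q \<phi> ^ j \<noteq> 0" if "j \<ge> 1" for \<phi> j
  proof
    assume "1 - q \<phi> ^ j = 0"
    then have "norm (q \<phi> ^ j) = 1" by simp
    then show False using assms that power_less_one_iff[of r j] by (simp add: norm_power nq)
  qed
  have contq: "continuous_on UNIV q" unfolding q_def by (intro continuous_intros)
  show ?thesis
    unfolding q_def[symmetric] using ne by (intro continuous_intros contq) auto
qed

text \<open>Inherited from the continuous partial products through the pointwise limit, which
  bypasses continuity of \<open>logchar\<close> in \<phi>.\<close>

lemma measurable_exp_logchar [measurable]:
  assumes "x > 0"
  shows "(\<lambda>\<phi>. exp (logchar x \<phi>)) \<in> borel_measurable borel"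
proof (rule borel_measurable_LIMSEQ_metric)
  show "(\<lambda>\<phi>. \<Prod>j\<in>{1..N}. (1 + (complex_of_real (exp (- x)) * cis \<phi>) ^ j) /
      (1 - (complex_of_real (exp (- x)) * cis \<phi>) ^ j)) \<in> borel_measurable borel" for N
    using assms by (intro borel_measurable_continuous_onI continuous_on_circle_overprod) auto
qed (rule overprod_tendsto[OF assms])

text \<open>No part of an overpartition of \<open>n\<close> exceeds \<open>n\<close>, so for
  \<open>N \<ge> n\<close> the truncated product already has the coefficient \<open>pbar n\<close>.
  The integrals are eventually constant in \<open>N\<close>, and dominated convergence, with the
  value at the positive real point as bound, carries them over to P.\<close>

lemma pbar_integral:
  assumes "x > 0"
  shows "integrable lborel (\<lambda>\<phi>. indicator {- pi..pi} \<phi> *\<^sub>R (exp (logchar x \<phi>) * cis (- (real n * \<phi>))))"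
    and "(LINT \<phi>|lborel. indicator {- pi..pi} \<phi> *\<^sub>R (exp (logchar x \<phi>) * cis (- (real n * \<phi>)))) =
           complex_of_real (2 * pi * pbar n * exp (- x) ^ n)"
proof -
  define r where "r = exp (- x)"
  have r: "0 < r" "r < 1" using assms by (auto simp: r_def)
  define q where "q \<phi> = complex_of_real r * cis \<phi>" for \<phi>
  have nq: "norm (q \<phi>) = r" for \<phi> using r by (simp add: q_def norm_mult)
  define P where "P N \<phi> = (\<Prod>j\<in>{1..N}. (1 + q \<phi> ^ j) / (1 - q \<phi> ^ j))" for N \<phi>
  have lim: "(\<lambda>N. P N \<phi>) \<longlonglongrightarrow> exp (logchar x \<phi>)" for \<phi>
    using overprod_tendsto[OF assms, of \<phi>] by (simp add: P_def q_def r_def)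
  have measP [measurable]: "P N \<in> borel_measurable borel" for N
    unfolding P_def q_def using r by (intro borel_measurable_continuous_onI continuous_on_circle_overprod)
  note measL [measurable] = measurable_exp_logchar[OF assms]
  have measc [measurable]: "(\<lambda>\<phi>. cis (- (real n * \<phi>))) \<in> borel_measurable borel"
    by (intro borel_measurable_continuous_onI continuous_intros)
  have normP: "norm (P N \<phi>) \<le> exp (mom 0 x)" for N \<phi>
  proof -
    have "norm (P N \<phi>) = (\<Prod>j\<in>{1..N}. norm (1 + q \<phi> ^ j) / norm (1 - q \<phi> ^ j))"
      by (simp add: P_def norm_divide flip: prod_norm)
    also have "\<dots> \<le> overprod N r"
      unfolding overprod_def
    proof (intro prod_mono conjI)
      fix j assume j: "j \<in> {1..N}"
      have "norm (1 + q \<phi> ^ j) \<le> 1 + r ^ j"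
        using norm_triangle_ineq[of 1 "q \<phi> ^ j"] by (simp add: norm_power nq)
      moreover have "1 - r ^ j \<le> norm (1 - q \<phi> ^ j)"
        using norm_triangle_ineq2[of 1 "q \<phi> ^ j"] by (simp add: norm_power nq)
      moreover have "0 < 1 - r ^ j" using j r by (simp add: power_less_one_iff)
      moreover have "0 \<le> 1 + r ^ j" using r by simp
      ultimately show "norm (1 + q \<phi> ^ j) / norm (1 - q \<phi> ^ j) \<le> (1 + r ^ j) / (1 - r ^ j)"
        by (intro frac_le) auto
    qed auto
    also have "\<dots> \<le> exp (mom 0 x)" unfolding r_def by (rule overprod_le_exp_mom[OF assms])
    finally show ?thesis .
  qed
  have dom: "integrable lborel (\<lambda>\<phi>. exp (mom 0 x) * indicator {- pi..pi} \<phi>)"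
    by simp
  have bound: "norm (indicator {- pi..pi} \<phi> *\<^sub>R (P N \<phi> * cis (- (real n * \<phi>)))) \<le>
      exp (mom 0 x) * indicator {- pi..pi} \<phi>" for N \<phi>
    using normP[of N \<phi>] by (auto simp: norm_mult split: split_indicator)
  have lim': "(\<lambda>N. indicator {- pi..pi} \<phi> *\<^sub>R (P N \<phi> * cis (- (real n * \<phi>)))) \<longlonglongrightarrow>
      indicator {- pi..pi} \<phi> *\<^sub>R (exp (logchar x \<phi>) * cis (- (real n * \<phi>)))" for \<phi>
    by (intro tendsto_intros lim)
  show "integrable lborel (\<lambda>\<phi>. indicator {- pi..pi} \<phi> *\<^sub>R (exp (logchar x \<phi>) * cis (- (real n * \<phi>))))"
    by (rule integrable_dominated_convergence[OF _ _ dom, where s = "\<lambda>N \<phi>. indicator {- pi..pi} \<phi> *\<^sub>R (P N \<phi> * cis (- (real n * \<phi>)))"])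
       (use lim' bound in auto)
  have "(\<lambda>N. LINT \<phi>|lborel. indicator {- pi..pi} \<phi> *\<^sub>R (P N \<phi> * cis (- (real n * \<phi>)))) \<longlonglongrightarrow>
      (LINT \<phi>|lborel. indicator {- pi..pi} \<phi> *\<^sub>R (exp (logchar x \<phi>) * cis (- (real n * \<phi>))))"
    by (rule integral_dominated_convergence[OF _ _ dom]) (use lim' bound in auto)
  moreover have "\<forall>\<^sub>F N in sequentially.
      (LINT \<phi>|lborel. indicator {- pi..pi} \<phi> *\<^sub>R (P N \<phi> * cis (- (real n * \<phi>)))) =
        complex_of_real (2 * pi * pbar n * r ^ n)"
    using eventually_ge_at_top[of n]
  proof eventually_elim
    case (elim N)
    define F where "F = ((\<Prod>j\<in>{1..N}. 1 + fps_X ^ j) * (\<Prod>j\<in>{1..N}. inverse (1 - fps_X ^ j)) :: complex fps)"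
    have "P N \<phi> = eval_fps F (of_real r * cis \<phi>)" for \<phi>
      unfolding F_def P_def using r
      by (subst fps_conv_radius_opset(2)) (auto simp: norm_mult q_def divide_inverse prod.distrib)
    then have "(LINT \<phi>|lborel. indicator {- pi..pi} \<phi> *\<^sub>R (P N \<phi> * cis (- (real n * \<phi>)))) =
        2 * pi * fps_nth F n * of_real r ^ n"
      using fps_coefficient_integral[of F r n] fps_conv_radius_opset(1)[of "{1..N}" "{1..N}"] r
      by (simp add: F_def)
    also have "fps_nth F n = of_nat (pbar n)"
      unfolding F_def pbar_def bij_betw_same_card[OF bij_betw_overpartitions[OF elim], symmetric]
      by (subst opset_fps) auto
    finally show ?case by simp
  qed
  ultimately have "(\<lambda>N. complex_of_real (2 * pi * pbar n * r ^ n)) \<longlonglongrightarrow>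
      (LINT \<phi>|lborel. indicator {- pi..pi} \<phi> *\<^sub>R (exp (logchar x \<phi>) * cis (- (real n * \<phi>))))"
    by (rule Lim_transform_eventually)
  then show "(LINT \<phi>|lborel. indicator {- pi..pi} \<phi> *\<^sub>R (exp (logchar x \<phi>) * cis (- (real n * \<phi>)))) =
           complex_of_real (2 * pi * pbar n * exp (- x) ^ n)"
    unfolding r_def[symmetric] by (rule LIMSEQ_unique[OF _ tendsto_const])
qed

section \<open>Local limit at the saddle point\<close>

text \<open>The neighbours of \<open>n\<close> contribute \<open>cis (- \<phi>)\<close> and
  \<open>cis \<phi>\<close>, with mean \<open>cos \<phi>\<close>. The nonnegative factor
  \<open>1 - cos \<phi>\<close> is the source of positivity: in the limit it turns the integral into
  a second moment of the Gaussian.\<close>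

lemma pbar_second_difference:
  assumes "x > 0" "n \<ge> 1"
  shows "(LINT \<phi>|lborel. indicator {- pi..pi} \<phi> *\<^sub>R
            (exp (logchar x \<phi> - mom 0 x - \<i> * complex_of_real (real n * \<phi>)) * complex_of_real (1 - cos \<phi>))) =
    complex_of_real (2 * pi * (pbar n * exp (- x) ^ n -
      (pbar (n + 1) * exp (- x) ^ (n + 1) + pbar (n - 1) * exp (- x) ^ (n - 1)) / 2) / exp (mom 0 x))"
proof -
  define J where "J k \<phi> = indicator {- pi..pi} \<phi> *\<^sub>R (exp (logchar x \<phi>) * cis (- (real k * \<phi>)))" for k \<phi>
  have int: "integrable lborel (J k)" for k
    unfolding J_def by (rule pbar_integral(1)[OF assms(1)])
  have val: "integral\<^sup>L lborel (J k) = complex_of_real (2 * pi * pbar k * exp (- x) ^ k)" for k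
    unfolding J_def by (rule pbar_integral(2)[OF assms(1)])
  have "indicator {- pi..pi} \<phi> *\<^sub>R
      (exp (logchar x \<phi> - mom 0 x - \<i> * complex_of_real (real n * \<phi>)) * complex_of_real (1 - cos \<phi>)) =
      (J n \<phi> - (J (n + 1) \<phi> + J (n - 1) \<phi>) * (1 / 2)) * exp (- complex_of_real (mom 0 x))" for \<phi>
  proof -
    have "cis (- (real (n + 1) * \<phi>)) + cis (- (real (n - 1) * \<phi>)) =
        cis (- (real n * \<phi>)) * complex_of_real (2 * cos \<phi>)"
    proof -
      have "cis (- (real (n + 1) * \<phi>)) = cis (- (real n * \<phi>)) * cis (- \<phi>)"
        "cis (- (real (n - 1) * \<phi>)) = cis (- (real n * \<phi>)) * cis \<phi>"
        using assms(2) by (simp_all add: cis_mult algebra_simps of_nat_diff)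
      moreover have "cis (- \<phi>) + cis \<phi> = complex_of_real (2 * cos \<phi>)"
        by (simp add: complex_eq_iff)
      ultimately show ?thesis by (simp only: distrib_left[symmetric])
    qed
    then have f1: "cis (- (real n * \<phi>)) * complex_of_real (1 - cos \<phi>) =
        cis (- (real n * \<phi>)) - (cis (- (real (n + 1) * \<phi>)) + cis (- (real (n - 1) * \<phi>))) * (1 / 2)"
      by (simp add: algebra_simps)
    have f2: "exp (logchar x \<phi> - mom 0 x - \<i> * complex_of_real (real n * \<phi>)) =
        exp (logchar x \<phi>) * cis (- (real n * \<phi>)) * exp (- complex_of_real (mom 0 x))"
      by (simp add: cis_conv_exp algebra_simps flip: exp_add)
    have "exp (logchar x \<phi> - mom 0 x - \<i> * complex_of_real (real n * \<phi>)) * complex_of_real (1 - cos \<phi>) =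
       exp (logchar x \<phi>) * exp (- complex_of_real (mom 0 x)) *
       (cis (- (real n * \<phi>)) - (cis (- (real (n + 1) * \<phi>)) + cis (- (real (n - 1) * \<phi>))) * (1 / 2))"
      unfolding f1[symmetric] f2 by (simp only: mult_ac)
    then show ?thesis
      unfolding J_def by (simp only: scaleR_conv_of_real) (simp only: algebra_simps)
  qed
  then have "(LINT \<phi>|lborel. indicator {- pi..pi} \<phi> *\<^sub>R
            (exp (logchar x \<phi> - mom 0 x - \<i> * complex_of_real (real n * \<phi>)) * complex_of_real (1 - cos \<phi>))) =
      (LINT \<phi>|lborel. (J n \<phi> - (J (n + 1) \<phi> + J (n - 1) \<phi>) * (1 / 2)) * exp (- complex_of_real (mom 0 x)))"
    by (simp only:)
  also have "\<dots> = (integral\<^sup>L lborel (J n) - (integral\<^sup>L lborel (J (n + 1)) + integral\<^sup>L lborel (J (n - 1))) * (1 / 2))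
      * exp (- complex_of_real (mom 0 x))"
    unfolding integral_mult_left_zero
    by (subst Bochner_Integration.integral_diff)
       (auto intro!: int Bochner_Integration.integrable_add integrable_mult_left
          simp: Bochner_Integration.integral_add[OF int int] integral_mult_left_zero)
  also have "\<dots> = complex_of_real (2 * pi * (pbar n * exp (- x) ^ n -
      (pbar (n + 1) * exp (- x) ^ (n + 1) + pbar (n - 1) * exp (- x) ^ (n - 1)) / 2) / exp (mom 0 x))"
    unfolding val by (simp add: exp_minus field_simps exp_of_real)
  finally show ?thesis .
qed

lemma gaussian_second_moment:
  "(LINT u|lborel. complex_of_real (exp (- u\<^sup>2 / 2) * (u\<^sup>2 / 2))) = complex_of_real (sqrt (2 * pi) / 2)"
proof -
  have "has_bochner_integral lborel (\<lambda>u. std_normal_density u * (u - 0) ^ (2 * 1)) (fact (2 * 1) / ((2 / 1\<^sup>2) ^ 1 * fact 1))"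
    by (rule normal_moment_even) simp
  then have "has_bochner_integral lborel (\<lambda>u. sqrt (2 * pi) / 2 * (std_normal_density u * u\<^sup>2)) (sqrt (2 * pi) / 2 * 1)"
    by (intro has_bochner_integral_mult_right) simp
  moreover have "(\<lambda>u. sqrt (2 * pi) / 2 * (std_normal_density u * u\<^sup>2)) =
      (\<lambda>u. exp (- u\<^sup>2 / 2) * (u\<^sup>2 / 2))"
    by (simp add: std_normal_density_def fun_eq_iff)
  ultimately have "has_bochner_integral lborel (\<lambda>u. exp (- u\<^sup>2 / 2) * (u\<^sup>2 / 2)) (sqrt (2 * pi) / 2)"
    by (simp only: mult_1_right)
  then have "has_bochner_integral lborel (\<lambda>u. complex_of_real (exp (- u\<^sup>2 / 2) * (u\<^sup>2 / 2))) (complex_of_real (sqrt (2 * pi) / 2))"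
    by (rule has_bochner_integral_of_real)
  then show ?thesis by (rule has_bochner_integral_integral_eq)
qed

text \<open>This yields the integrable majorant after the scaling
  \<open>\<phi> = u / \<sigma>\<close>. The hypothesis on \<open>x ^ 3 * u\<^sup>2\<close> combines
  \<bar>\<phi>\<bar> \<le> pi < 4 with \<open>\<sigma>\<^sup>2 * x ^ 3 \<le> C\<close>.\<close>

lemma saddle_tail_bound:
  fixes C :: real
  assumes "C > 0"
  obtains K where "\<And>x u :: real. 0 < x \<Longrightarrow> x ^ 3 * u\<^sup>2 \<le> 16 * C \<Longrightarrow>
    u\<^sup>2 * exp (- (u\<^sup>2 / (8 * (C + x * u\<^sup>2)))) \<le> K * inverse (1 + u\<^sup>2)"
proof -
  \<comment> \<open>Why sixth powers: for \<open>v = u\<^sup>2 > 1\<close> the hypothesis keeps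
    \<open>D = C + x * v\<close> within order v^(2/3), so v / D is at least of order v^(1/3), and
    its sixth power absorbs \<open>v ^ 2\<close>.\<close>
  define B where "B = 64 * (C ^ 6 + (16 * C)\<^sup>2)"
  define K where "K = 2 + 2 * (fact 6 * 8 ^ 6 * B)"
  have B: "B \<ge> 0" using assms by (simp add: B_def)
  show thesis
  proof (rule that[of K])
    fix x u :: real assume x: "0 < x" and xu: "x ^ 3 * u\<^sup>2 \<le> 16 * C"
    define D where "D = C + x * u\<^sup>2"
    have D: "D > 0" unfolding D_def using assms x by (intro add_pos_nonneg) auto
    have "u\<^sup>2 * (1 + u\<^sup>2) * exp (- (u\<^sup>2 / (8 * D))) \<le> K"
    proof (cases "u\<^sup>2 \<le> 1")
      case True
      have "u\<^sup>2 * (1 + u\<^sup>2) * exp (- (u\<^sup>2 / (8 * D))) \<le> 1 * 2 * 1"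
        using True D by (intro mult_mono) auto
      also have "\<dots> \<le> K" using B by (simp add: K_def)
      finally show ?thesis .
    next
      case False
      then have u: "u\<^sup>2 > 1" by simp
      define v where "v = u\<^sup>2"
      have v: "v > 1" using u by (simp add: v_def)
      have "D ^ 6 \<le> B * v ^ 4"
      proof -
        have m: "(a + b) ^ 6 \<le> 64 * (a ^ 6 + b ^ 6)" if "a \<ge> 0" "b \<ge> 0" for a b :: real
        proof -
          have "(a + b) ^ 6 \<le> (2 * max a b) ^ 6" using that by (intro power_mono) auto
          also have "\<dots> = 64 * max a b ^ 6" by (simp add: power_mult_distrib)
          also have "max a b ^ 6 \<le> a ^ 6 + b ^ 6" using that by (auto simp: max_def)
          finally show ?thesis by simp
        qed
        have "D ^ 6 \<le> 64 * (C ^ 6 + (x * v) ^ 6)"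
          unfolding D_def v_def using assms x by (intro m) auto
        also have "(x * v) ^ 6 = (x ^ 3 * v)\<^sup>2 * v ^ 4"
          by (simp add: power_mult_distrib flip: power_mult power_add)
        also have "(x ^ 3 * v)\<^sup>2 * v ^ 4 \<le> (16 * C)\<^sup>2 * v ^ 4"
          using xu x v by (intro mult_right_mono power_mono) (auto simp: v_def)
        also have "C ^ 6 \<le> C ^ 6 * v ^ 4"
          using assms v by (simp add: one_le_power)
        finally show ?thesis by (simp add: B_def algebra_simps)
      qed
      have "(v / (8 * D)) ^ 6 \<le> fact 6 * exp (v / (8 * D))"
        using v D by (intro power_le_fact_exp) auto
      then have "exp (- (v / (8 * D))) * (v / (8 * D)) ^ 6 \<le> exp (- (v / (8 * D))) * (fact 6 * exp (v / (8 * D)))"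
        by (intro mult_left_mono) auto
      also have "\<dots> = fact 6" by (simp add: exp_minus)
      finally have "exp (- (v / (8 * D))) * v ^ 6 \<le> fact 6 * 8 ^ 6 * D ^ 6"
        using D by (simp add: power_divide power_mult_distrib field_simps)
      also have "\<dots> \<le> fact 6 * 8 ^ 6 * (B * v ^ 4)"
        using \<open>D ^ 6 \<le> B * v ^ 4\<close> by (intro mult_left_mono) auto
      finally have "(exp (- (v / (8 * D))) * v ^ 2) * v ^ 4 \<le> (fact 6 * 8 ^ 6 * B) * v ^ 4"
        by (simp add: mult_ac flip: power_add)
      then have e: "exp (- (v / (8 * D))) * v ^ 2 \<le> fact 6 * 8 ^ 6 * B"
        by (rule mult_right_le_imp_le) (use v in simp)
      have "v * (1 + v) * exp (- (v / (8 * D))) \<le> (v * (2 * v)) * exp (- (v / (8 * D)))"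
        using v by (intro mult_right_mono mult_left_mono) auto
      also have "\<dots> = 2 * (exp (- (v / (8 * D))) * v ^ 2)"
        by (simp add: power2_eq_square)
      also have "\<dots> \<le> K" using e by (simp add: K_def)
      finally show ?thesis by (simp add: v_def)
    qed
    moreover have "1 + u\<^sup>2 > 0" by (simp add: add_pos_nonneg)
    ultimately show "u\<^sup>2 * exp (- (u\<^sup>2 / (8 * (C + x * u\<^sup>2)))) \<le> K * inverse (1 + u\<^sup>2)"
      by (simp add: D_def field_simps)
  qed
qed

text \<open>The scaled integrand tends to \<open>exp (- u\<^sup>2 / 2) * (u\<^sup>2 / 2)\<close>,
  the variance normalising the quadratic term and the cubic error vanishing. The limit constant is
  the integral of this function divided by \<open>2 * pi\<close>.\<close>

lemma pbar_second_difference_asymptotics: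
  obtains \<xi> \<sigma> :: "nat \<Rightarrow> real" and C :: real where
    "\<And>n. 0 < \<xi> n" "\<xi> \<longlonglongrightarrow> 0" "\<And>n. 0 < \<sigma> n" "\<And>n. (\<sigma> n)\<^sup>2 * \<xi> n ^ 3 \<le> C"
    "(\<lambda>n. \<sigma> n ^ 3 * ((pbar n * exp (- \<xi> n) ^ n - (pbar (n + 1) * exp (- \<xi> n) ^ (n + 1) +
        pbar (n - 1) * exp (- \<xi> n) ^ (n - 1)) / 2) / exp (mom 0 (\<xi> n)))) \<longlonglongrightarrow> sqrt (2 * pi) / 2 / (2 * pi)"
proof -
  obtain \<xi> :: "nat \<Rightarrow> real" where \<xi>: "\<And>n. 0 < \<xi> n" "\<And>n. \<xi> n \<le> 1 / 2"
      and mean: "\<forall>\<^sub>F n in sequentially. mom 1 (\<xi> n) = real n" and \<xi>0: "\<xi> \<longlonglongrightarrow> 0"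
    by (rule saddle_points) (rule that)
  define \<sigma> where "\<sigma> n = sqrt (mom 2 (\<xi> n))" for n
  have low: "2 * exp (- 4) / \<xi> n ^ 3 \<le> mom 2 (\<xi> n)" for n
    using mom_lower[of "\<xi> n" 2] \<xi>[of n] by (simp add: numeral_3_eq_3)
  have mpos: "0 < mom 2 (\<xi> n)" for n
    using \<xi>(1)[of n] by (intro less_le_trans[OF _ low]) simp
  have \<sigma>: "0 < \<sigma> n" "(\<sigma> n)\<^sup>2 = mom 2 (\<xi> n)" for n
    using mpos[of n] by (auto simp: \<sigma>_def)
  obtain C where C: "C > 0" "\<And>x. x > 0 \<Longrightarrow> mom 2 x \<le> C / x ^ (2 + 1)"
    using mom_upper[of 2] by auto
  have \<sigma>C: "(\<sigma> n)\<^sup>2 * \<xi> n ^ 3 \<le> C" for n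
    using C(2)[of "\<xi> n"] \<xi>(1)[of n] unfolding \<sigma>(2) by (simp add: field_simps power3_eq_cube)
  have \<xi>_at_right: "filterlim \<xi> (at_right 0) sequentially"
    using \<xi>0 \<xi>(1) less_imp_neq[OF \<xi>(1)] by (auto simp: filterlim_at intro!: always_eventually)
  have \<sigma>_low: "sqrt (2 * exp (- 4) / \<xi> n ^ 3) \<le> \<sigma> n" for n
    using low by (simp add: \<sigma>_def)
  have \<sigma>_top: "filterlim \<sigma> at_top sequentially"
  proof (rule filterlim_at_top_mono[OF _ always_eventually])
    have "filterlim (\<lambda>x::real. sqrt (2 * exp (- 4) / x ^ 3)) at_top (at_right 0)"
      by real_asymp
    then show "filterlim (\<lambda>n. sqrt (2 * exp (- 4) / \<xi> n ^ 3)) at_top sequentially"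
      by (rule filterlim_compose[OF _ \<xi>_at_right])
  qed (use \<sigma>_low in auto)
  \<comment> \<open>The numerator is at most of order x^(-4) and \<sigma>^3 at least of order
    x^(-9/2), for x = \<xi> n, so the quotient is at most of order x^(1/2).\<close>
  have skew: "(\<lambda>n. mom 3 (\<xi> n) / \<sigma> n ^ 3) \<longlonglongrightarrow> 0"
  proof -
    obtain A where A: "A > 0" "\<And>x. x > 0 \<Longrightarrow> mom 3 x \<le> A / x ^ (3 + 1)"
      using mom_upper[of 3] by auto
    have "((\<lambda>x::real. (A / x ^ (3 + 1)) / (sqrt (2 * exp (- 4) / x ^ 3)) ^ 3) \<longlongrightarrow> 0) (at_right 0)"
      using A(1) by real_asymp
    then have lim: "(\<lambda>n. (A / \<xi> n ^ (3 + 1)) / (sqrt (2 * exp (- 4) / \<xi> n ^ 3)) ^ 3) \<longlonglongrightarrow> 0"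
      by (rule filterlim_compose[OF _ \<xi>_at_right])
    show ?thesis
    proof (rule tendsto_sandwich[OF always_eventually always_eventually tendsto_const lim]; intro allI)
      fix n
      have m3: "0 \<le> mom 3 (\<xi> n)" unfolding mom_def by (intro infsum_nonneg) auto
      then show "0 \<le> mom 3 (\<xi> n) / \<sigma> n ^ 3" using \<sigma>(1)[of n] by simp
      show "mom 3 (\<xi> n) / \<sigma> n ^ 3 \<le> (A / \<xi> n ^ (3 + 1)) / (sqrt (2 * exp (- 4) / \<xi> n ^ 3)) ^ 3"
        using \<xi>(1)[of n] A m3 \<sigma>_low[of n] by (intro frac_le power_mono) auto
    qed
  qed
  have inv_\<sigma>: "(\<lambda>n. t / \<sigma> n) \<longlonglongrightarrow> 0" for t
    by (rule real_tendsto_divide_at_top[OF tendsto_const \<sigma>_top])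

  define h where "h n \<phi> = indicator {- pi..pi} \<phi> *\<^sub>R
      (exp (logchar (\<xi> n) \<phi> - mom 0 (\<xi> n) - \<i> * complex_of_real (real n * \<phi>)) * complex_of_real (1 - cos \<phi>))" for n \<phi>
  \<comment> \<open>Two of the three powers of \<sigma> compensate
    \<open>1 - cos (u / \<sigma> n)\<close>; the third comes from the substitution.\<close>
  define s where "s n u = complex_of_real ((\<sigma> n)\<^sup>2) * h n (u / \<sigma> n)" for n u
  have int_s: "integral\<^sup>L lborel (s n) = complex_of_real (\<sigma> n ^ 3) * integral\<^sup>L lborel (h n)" for n
  proof -
    have "integral\<^sup>L lborel (h n) = \<bar>1 / \<sigma> n\<bar> *\<^sub>R (LINT u|lborel. h n (0 + 1 / \<sigma> n * u))"
      using \<sigma>(1)[of n] by (intro lborel_integral_real_affine) auto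
    then have "complex_of_real (\<sigma> n ^ 3) * integral\<^sup>L lborel (h n) =
        complex_of_real (\<sigma> n ^ 3 * (1 / \<sigma> n)) * (LINT u|lborel. h n (u / \<sigma> n))"
      using \<sigma>(1)[of n] by (simp add: scaleR_conv_of_real)
    also have "\<sigma> n ^ 3 * (1 / \<sigma> n) = (\<sigma> n)\<^sup>2"
      using \<sigma>(1)[of n] by (simp add: power3_eq_cube power2_eq_square)
    finally show ?thesis unfolding s_def by simp
  qed
  have meas_h [measurable]: "h n \<in> borel_measurable borel" for n
  proof -
    note [measurable] = measurable_exp_logchar[OF \<xi>(1)[of n]]
    have c [measurable]: "(\<lambda>\<phi>. cis (- (real n * \<phi>))) \<in> borel_measurable borel"
      by (intro borel_measurable_continuous_onI continuous_intros)
    have "h n = (\<lambda>\<phi>. indicator {- pi..pi} \<phi> *\<^sub>R (exp (logchar (\<xi> n) \<phi>) *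
        exp (- complex_of_real (mom 0 (\<xi> n))) * cis (- (real n * \<phi>)) * complex_of_real (1 - cos \<phi>)))"
      by (auto simp: h_def fun_eq_iff cis_conv_exp algebra_simps simp flip: exp_add)
    then show ?thesis by simp
  qed
  obtain K where K: "\<And>x u :: real. 0 < x \<Longrightarrow> x ^ 3 * u\<^sup>2 \<le> 16 * C \<Longrightarrow>
      u\<^sup>2 * exp (- (u\<^sup>2 / (8 * (C + x * u\<^sup>2)))) \<le> K * inverse (1 + u\<^sup>2)"
    using saddle_tail_bound[OF C(1)] by blast
  have dom: "integrable lborel (\<lambda>u::real. K * inverse (1 + u\<^sup>2))"
    using integrable_inverse_1_plus_square
    by (intro integrable_mult_right) (simp add: set_integrable_def einterval_def)
  have bound: "norm (s n u) \<le> K * inverse (1 + u\<^sup>2)" for n u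
  proof -
    define \<phi> where "\<phi> = u / \<sigma> n"
    define x where "x = \<xi> n"
    have x: "0 < x" "x \<le> 1 / 2" using \<xi> by (auto simp: x_def)
    have u: "u = \<phi> * \<sigma> n" using \<sigma>(1)[of n] by (simp add: \<phi>_def)
    have K0: "0 \<le> K * inverse (1 + u\<^sup>2)"
    proof -
      have "0 \<le> K" using K[of 1 0] C by simp
      then show ?thesis by (intro mult_nonneg_nonneg) auto
    qed
    show ?thesis
    proof (cases "\<bar>\<phi>\<bar> \<le> pi")
      case False
      then have "s n u = 0" by (auto simp: s_def h_def \<phi>_def indicator_def)
      then show ?thesis using K0 by simp
    next
      case True
      have c: "1 - cos \<phi> \<le> \<phi>\<^sup>2 / 2"
      proof -
        have "cos \<phi> = 1 - 2 * (sin (\<phi> / 2))\<^sup>2" using cos_double_sin[of "\<phi> / 2"] by simp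
        moreover have "(sin (\<phi> / 2))\<^sup>2 \<le> (\<phi> / 2)\<^sup>2"
          using abs_sin_x_le_abs_x[of "\<phi> / 2"] by (simp only: abs_le_square_iff)
        ultimately show ?thesis by (simp add: power_divide)
      qed
      have "\<phi>\<^sup>2 \<le> 16"
      proof -
        have "\<bar>\<phi>\<bar> ^ 2 \<le> 4 ^ 2" using True pi_less_4 by (intro power_mono) auto
        then show ?thesis by simp
      qed
      then have "x ^ 3 * u\<^sup>2 \<le> 16 * ((\<sigma> n)\<^sup>2 * x ^ 3)"
        using mult_right_mono[of "\<phi>\<^sup>2" 16 "(\<sigma> n)\<^sup>2 * x ^ 3"] x by (simp add: u power_mult_distrib mult_ac)
      also have "\<dots> \<le> 16 * C" using \<sigma>C[of n] by (simp add: x_def)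
      finally have Ku: "u\<^sup>2 * exp (- (u\<^sup>2 / (8 * (C + x * u\<^sup>2)))) \<le> K * inverse (1 + u\<^sup>2)"
        using x by (intro K)
      have "norm (s n u) = (\<sigma> n)\<^sup>2 * (exp (Re (logchar x \<phi>) - mom 0 x) * (1 - cos \<phi>))"
      proof -
        have "norm (complex_of_real (1 - cos \<phi>)) = 1 - cos \<phi>"
          by (simp only: norm_of_real) simp
        then show ?thesis
          using True by (simp add: s_def h_def norm_mult norm_power \<phi>_def[symmetric] x_def[symmetric] abs_le_iff del: of_real_diff)
      qed
      also have "\<dots> \<le> (\<sigma> n)\<^sup>2 * (exp (- (u\<^sup>2 / (8 * (C + x * u\<^sup>2)))) * (\<phi>\<^sup>2 / 2))"
      proof (intro mult_left_mono mult_mono c)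
        have "u\<^sup>2 / (8 * (C + x * u\<^sup>2)) \<le> \<phi>\<^sup>2 / (8 * x * (x\<^sup>2 + \<phi>\<^sup>2))"
        proof -
          \<comment> \<open>Expanding by \<sigma>^2 expresses the fraction through \<open>u\<close>
            and the bounded quantity \<open>\<sigma>\<^sup>2 * x ^ 3\<close>, which is then enlarged
            to \<open>C\<close>.\<close>
          have "\<phi>\<^sup>2 / (8 * x * (x\<^sup>2 + \<phi>\<^sup>2)) = (\<phi>\<^sup>2 * (\<sigma> n)\<^sup>2) / (8 * x * (x\<^sup>2 + \<phi>\<^sup>2) * (\<sigma> n)\<^sup>2)"
            using \<sigma>(1)[of n] by simp
          also have "8 * x * (x\<^sup>2 + \<phi>\<^sup>2) * (\<sigma> n)\<^sup>2 = 8 * ((\<sigma> n)\<^sup>2 * x ^ 3 + x * u\<^sup>2)"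
            by (simp add: u power_mult_distrib algebra_simps power2_eq_square power3_eq_cube)
          also have "\<phi>\<^sup>2 * (\<sigma> n)\<^sup>2 = u\<^sup>2" by (simp add: u power_mult_distrib)
          also have "u\<^sup>2 / (8 * (C + x * u\<^sup>2)) \<le> u\<^sup>2 / (8 * ((\<sigma> n)\<^sup>2 * x ^ 3 + x * u\<^sup>2))"
            using \<sigma>C[of n] \<sigma>(1)[of n] x C(1)
            by (intro divide_left_mono mult_left_mono add_right_mono mult_pos_pos add_pos_nonneg)
               (auto simp: x_def)
          finally show ?thesis .
        qed
        then show "exp (Re (logchar x \<phi>) - mom 0 x) \<le> exp (- (u\<^sup>2 / (8 * (C + x * u\<^sup>2))))"
          using Re_logchar_le[OF x True] by simp
      qed auto
      also have "\<dots> = (u\<^sup>2 * exp (- (u\<^sup>2 / (8 * (C + x * u\<^sup>2))))) / 2"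
        by (simp add: u power_mult_distrib mult_ac)
      also have "\<dots> \<le> K * inverse (1 + u\<^sup>2)"
        using Ku K0 by linarith
      finally show ?thesis .
    qed
  qed
  have lim: "(\<lambda>n. s n u) \<longlonglongrightarrow> complex_of_real (exp (- u\<^sup>2 / 2) * (u\<^sup>2 / 2))" for u
  proof -
    define E where "E n = logchar (\<xi> n) (u / \<sigma> n) - mom 0 (\<xi> n) - \<i> * complex_of_real (real n * (u / \<sigma> n))" for n
    have "(\<lambda>n. E n - complex_of_real (- u\<^sup>2 / 2)) \<longlonglongrightarrow> 0"
    proof (rule Lim_null_comparison)
      show "\<forall>\<^sub>F n in sequentially. norm (E n - complex_of_real (- u\<^sup>2 / 2)) \<le>
          \<bar>u\<bar> ^ 3 / 6 * (mom 3 (\<xi> n) / \<sigma> n ^ 3)"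
        using mean
      proof eventually_elim
        case (elim n)
        have "complex_of_real ((u / \<sigma> n)\<^sup>2 / 2 * mom 2 (\<xi> n)) = complex_of_real (u\<^sup>2 / 2)"
          using \<sigma>[of n] by (simp add: power_divide flip: \<sigma>(2))
        \<comment> \<open>Here the saddle point enters: \<open>mom 1 (\<xi> n) = real n\<close>
          matches the linear terms.\<close>
        then have "E n - complex_of_real (- u\<^sup>2 / 2) = logchar (\<xi> n) (u / \<sigma> n) -
            (mom 0 (\<xi> n) + \<i> * (u / \<sigma> n) * mom 1 (\<xi> n) - (u / \<sigma> n)\<^sup>2 / 2 * mom 2 (\<xi> n))"
          unfolding E_def elim by (simp add: algebra_simps)
        then have "norm (E n - complex_of_real (- u\<^sup>2 / 2)) \<le> \<bar>u / \<sigma> n\<bar> ^ 3 / 6 * mom 3 (\<xi> n)"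
          using logchar_expansion[OF \<xi>(1)[of n], of "u / \<sigma> n"] by (simp only:)
        also have "\<bar>u / \<sigma> n\<bar> ^ 3 = \<bar>u\<bar> ^ 3 / \<sigma> n ^ 3"
          using \<sigma>(1)[of n] by (simp add: power_divide)
        finally show ?case by simp
      qed
      show "(\<lambda>n. \<bar>u\<bar> ^ 3 / 6 * (mom 3 (\<xi> n) / \<sigma> n ^ 3)) \<longlonglongrightarrow> 0"
        by (rule tendsto_mult_right_zero[OF skew])
    qed
    then have E: "E \<longlonglongrightarrow> complex_of_real (- u\<^sup>2 / 2)"
      by (simp only: LIM_zero_iff)
    have c: "(\<lambda>n. (\<sigma> n)\<^sup>2 * (1 - cos (u / \<sigma> n))) \<longlonglongrightarrow> u\<^sup>2 / 2"
    proof (rule LIM_zero_cancel, rule Lim_null_comparison[OF always_eventually])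
      show "\<forall>n. norm ((\<sigma> n)\<^sup>2 * (1 - cos (u / \<sigma> n)) - u\<^sup>2 / 2) \<le> u ^ 2 / 24 * (u / \<sigma> n)\<^sup>2"
      proof
        fix n
        have "(\<sigma> n)\<^sup>2 * (1 - cos (u / \<sigma> n)) - u\<^sup>2 / 2 = - ((\<sigma> n)\<^sup>2 * (cos (u / \<sigma> n) - (1 - (u / \<sigma> n)\<^sup>2 / 2)))"
          using \<sigma>(1)[of n] by (simp add: power_divide field_simps)
        then have "norm ((\<sigma> n)\<^sup>2 * (1 - cos (u / \<sigma> n)) - u\<^sup>2 / 2) =
            (\<sigma> n)\<^sup>2 * \<bar>cos (u / \<sigma> n) - (1 - (u / \<sigma> n)\<^sup>2 / 2)\<bar>"
          by (simp only: real_norm_def abs_minus_cancel abs_mult abs_power2)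
        also have "\<dots> \<le> (\<sigma> n)\<^sup>2 * ((u / \<sigma> n) ^ 4 / 24)"
          by (intro mult_left_mono abs_cos_minus_quadratic_le) auto
        also have "\<dots> = u ^ 2 / 24 * (u / \<sigma> n)\<^sup>2"
          using \<sigma>(1)[of n] by (simp add: field_simps power2_eq_square power4_eq_xxxx)
        finally show "norm ((\<sigma> n)\<^sup>2 * (1 - cos (u / \<sigma> n)) - u\<^sup>2 / 2) \<le> u ^ 2 / 24 * (u / \<sigma> n)\<^sup>2" .
      qed
      show "(\<lambda>n. u ^ 2 / 24 * (u / \<sigma> n)\<^sup>2) \<longlonglongrightarrow> 0"
        using tendsto_power[OF inv_\<sigma>[of u], of 2] by (intro tendsto_mult_right_zero) simp
    qed
    have "(\<lambda>n. exp (E n) * complex_of_real ((\<sigma> n)\<^sup>2 * (1 - cos (u / \<sigma> n)))) \<longlonglongrightarrow>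
        exp (complex_of_real (- u\<^sup>2 / 2)) * complex_of_real (u\<^sup>2 / 2)"
      by (intro tendsto_mult tendsto_exp E tendsto_of_real c)
    moreover have "\<forall>\<^sub>F n in sequentially. exp (E n) * complex_of_real ((\<sigma> n)\<^sup>2 * (1 - cos (u / \<sigma> n))) = s n u"
    proof -
      have "\<forall>\<^sub>F n in sequentially. \<bar>u / \<sigma> n\<bar> < pi"
        using tendsto_rabs[OF inv_\<sigma>[of u]] pi_gt_zero by (intro order_tendstoD(2)) auto
      then show ?thesis
      proof eventually_elim
        case (elim n)
        then have "u / \<sigma> n \<in> {- pi..pi}" unfolding abs_less_iff atLeastAtMost_iff by linarith
        then have "indicator {- pi..pi} (u / \<sigma> n) = (1 :: real)" by (rule indicator_simps)
        then show ?case by (simp add: s_def h_def E_def mult_ac)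
      qed
    qed
    ultimately have "(\<lambda>n. s n u) \<longlonglongrightarrow> exp (complex_of_real (- u\<^sup>2 / 2)) * complex_of_real (u\<^sup>2 / 2)"
      by (rule Lim_transform_eventually)
    then show ?thesis by (simp only: of_real_mult exp_of_real)
  qed
  have "(\<lambda>n. integral\<^sup>L lborel (s n)) \<longlonglongrightarrow>
      (LINT u|lborel. complex_of_real (exp (- u\<^sup>2 / 2) * (u\<^sup>2 / 2)))"
  proof (rule integral_dominated_convergence[OF _ _ dom])
    show "s n \<in> borel_measurable lborel" for n unfolding s_def by simp
  qed (use lim bound in auto)
  then have "(\<lambda>n. complex_of_real (\<sigma> n ^ 3) * integral\<^sup>L lborel (h n)) \<longlonglongrightarrow> complex_of_real (sqrt (2 * pi) / 2)"
    by (simp only: int_s gaussian_second_moment)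
  moreover define D where "D n = (pbar n * exp (- \<xi> n) ^ n - (pbar (n + 1) * exp (- \<xi> n) ^ (n + 1) +
        pbar (n - 1) * exp (- \<xi> n) ^ (n - 1)) / 2) / exp (mom 0 (\<xi> n))" for n
  have "\<forall>\<^sub>F n in sequentially. complex_of_real (\<sigma> n ^ 3) * integral\<^sup>L lborel (h n) =
      complex_of_real (2 * pi * (\<sigma> n ^ 3 * D n))"
    using eventually_ge_at_top[of 1]
  proof eventually_elim
    case (elim n)
    have "integral\<^sup>L lborel (h n) = complex_of_real (2 * pi * D n)"
      unfolding h_def D_def using pbar_second_difference[OF \<xi>(1)[of n] elim] by simp
    then show ?case by simp
  qed
  ultimately have "(\<lambda>n. complex_of_real (2 * pi * (\<sigma> n ^ 3 * D n))) \<longlonglongrightarrow> complex_of_real (sqrt (2 * pi) / 2)"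
    by (rule Lim_transform_eventually)
  then have "(\<lambda>n. 2 * pi * (\<sigma> n ^ 3 * D n) / (2 * pi)) \<longlonglongrightarrow> sqrt (2 * pi) / 2 / (2 * pi)"
    unfolding tendsto_of_real_iff by (intro tendsto_divide tendsto_const) auto
  then have "(\<lambda>n. \<sigma> n ^ 3 * D n) \<longlonglongrightarrow> sqrt (2 * pi) / 2 / (2 * pi)" by simp
  then show thesis
    using that[of \<xi> \<sigma> C] \<xi>(1) \<xi>0 \<sigma>(1) \<sigma>C unfolding D_def by blast
qed

section \<open>Log-concavity\<close>

text \<open>The strict inequality against the mean of the neighbours survives the passage from
  \<open>pbar\<close> to \<open>c * N2bar a c\<close>, since the equidistribution error is of
  smaller order than the excess. The factor \<open>c\<close> and the weights then cancel from the
  product inequality.\<close>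

lemma eventually_N2bar_log_concave:
  fixes a c :: int
  assumes "c \<ge> 2"
  shows "\<forall>\<^sub>F n in sequentially. N2bar a c (n - 1) * N2bar a c (n + 1) < N2bar a c n ^ 2"
proof -
  obtain \<xi> \<sigma> :: "nat \<Rightarrow> real" and B where \<xi>: "\<And>n. 0 < \<xi> n" "\<xi> \<longlonglongrightarrow> 0"
    and \<sigma>: "\<And>n. 0 < \<sigma> n" "\<And>n. (\<sigma> n)\<^sup>2 * \<xi> n ^ 3 \<le> B"
    and lim: "(\<lambda>n. \<sigma> n ^ 3 * ((pbar n * exp (- \<xi> n) ^ n - (pbar (n + 1) * exp (- \<xi> n) ^ (n + 1) +
        pbar (n - 1) * exp (- \<xi> n) ^ (n - 1)) / 2) / exp (mom 0 (\<xi> n)))) \<longlonglongrightarrow> sqrt (2 * pi) / 2 / (2 * pi)"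
    by (rule pbar_second_difference_asymptotics) (rule that)
  obtain C where C: "C \<ge> 0" "\<And>n N r. n \<le> N \<Longrightarrow> 1029 \<le> N \<Longrightarrow> 0 < r \<Longrightarrow> r < 1 \<Longrightarrow>
       \<bar>real_of_int c * N2bar a c n - pbar n\<bar> * r ^ n \<le> C * (1 - r) ^ 5 * overprod N r"
    by (rule N2bar_approx[OF assms]) (rule that)
  have err: "\<bar>real_of_int c * N2bar a c k - pbar k\<bar> * exp (- x) ^ k \<le> C * x ^ 5 * exp (mom 0 x)"
    if x: "x > 0" for x k
  proof -
    \<comment> \<open>Truncation at \<open>k + 1029\<close> meets both requirements on
      \<open>N\<close>; the bound by P that follows is free of it.\<close>
    have "\<bar>real_of_int c * N2bar a c k - pbar k\<bar> * exp (- x) ^ k \<le>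
        C * (1 - exp (- x)) ^ 5 * overprod (k + 1029) (exp (- x))"
      using x by (intro C) auto
    also have "\<dots> \<le> C * (1 - exp (- x)) ^ 5 * exp (mom 0 x)"
      using C(1) x by (intro mult_left_mono overprod_le_exp_mom) auto
    also have "\<dots> \<le> C * x ^ 5 * exp (mom 0 x)"
      using C(1) x exp_ge_add_one_self[of "- x"]
      by (intro mult_right_mono mult_left_mono power_mono) auto
    finally show ?thesis .
  qed
  define D where "D n = (pbar n * exp (- \<xi> n) ^ n - (pbar (n + 1) * exp (- \<xi> n) ^ (n + 1) +
        pbar (n - 1) * exp (- \<xi> n) ^ (n - 1)) / 2) / exp (mom 0 (\<xi> n))" for n
  \<comment> \<open>The square is a bounded quantity times \<open>\<xi> n\<close>. With exponent 4
    in place of 5 the last factor would be \<open>1 / \<xi> n\<close>, which is why five pairs are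
    used.\<close>
  have small: "(\<lambda>n. \<sigma> n ^ 3 * \<xi> n ^ 5) \<longlonglongrightarrow> 0"
  proof (rule tendsto_sandwich[OF always_eventually always_eventually tendsto_const])
    show "\<forall>n. 0 \<le> \<sigma> n ^ 3 * \<xi> n ^ 5"
      using \<sigma>(1) \<xi>(1) by (simp add: less_imp_le)
    show "\<forall>n. \<sigma> n ^ 3 * \<xi> n ^ 5 \<le> sqrt (B ^ 3 * \<xi> n)"
    proof (intro allI real_le_rsqrt)
      fix n
      have "(\<sigma> n ^ 3 * \<xi> n ^ 5)\<^sup>2 = ((\<sigma> n)\<^sup>2 * \<xi> n ^ 3) ^ 3 * \<xi> n"
        by (simp add: power_mult_distrib mult.assoc flip: power_mult power_Suc2)
      also have "\<dots> \<le> B ^ 3 * \<xi> n"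
        using \<sigma> \<xi>(1) by (intro mult_right_mono power_mono) (auto simp: less_imp_le)
      finally show "(\<sigma> n ^ 3 * \<xi> n ^ 5)\<^sup>2 \<le> B ^ 3 * \<xi> n" .
    qed
    show "(\<lambda>n. sqrt (B ^ 3 * \<xi> n)) \<longlonglongrightarrow> 0"
      using tendsto_real_sqrt[OF tendsto_mult_right_zero[OF \<xi>(2)]] by simp
  qed
  \<comment> \<open>Relative to P, the error may lower the middle term by
    \<open>C * \<xi> n ^ 5\<close> and raise the mean of the neighbours by as much, whence the
    factor 2.\<close>
  have "(\<lambda>n. \<sigma> n ^ 3 * D n - 2 * C * (\<sigma> n ^ 3 * \<xi> n ^ 5)) \<longlonglongrightarrow>
      sqrt (2 * pi) / 2 / (2 * pi) - 2 * C * 0"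
    by (intro tendsto_intros small lim[folded D_def])
  then have "\<forall>\<^sub>F n in sequentially. 0 < \<sigma> n ^ 3 * D n - 2 * C * (\<sigma> n ^ 3 * \<xi> n ^ 5)"
    by (rule order_tendstoD(1)) simp
  then show ?thesis
    using eventually_ge_at_top[of 1]
  proof eventually_elim
    case (elim n)
    define r where "r = exp (- \<xi> n)"
    define P where "P = exp (mom 0 (\<xi> n))"
    define \<alpha> where "\<alpha> k = real_of_int c * N2bar a c k * r ^ k" for k
    have rP: "0 < r" "0 < P" by (simp_all add: r_def P_def)
    have c: "0 < real_of_int c" using assms by simp
    have e: "\<bar>\<alpha> k - pbar k * r ^ k\<bar> \<le> C * \<xi> n ^ 5 * P" for k
      using err[OF \<xi>(1)[of n], of k] rP unfolding \<alpha>_def r_def P_def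
      by (simp add: abs_mult flip: left_diff_distrib)
    have "0 < \<sigma> n ^ 3 * (D n - 2 * C * \<xi> n ^ 5)"
      using elim(1) by (simp add: algebra_simps)
    then have "0 < D n - 2 * C * \<xi> n ^ 5"
      using \<sigma>(1)[of n] by (simp add: zero_less_mult_iff)
    then have "2 * C * \<xi> n ^ 5 * P < D n * P"
      using rP by (simp add: mult_strict_right_mono)
    also have "D n * P = pbar n * r ^ n - (pbar (n + 1) * r ^ (n + 1) + pbar (n - 1) * r ^ (n - 1)) / 2"
      using rP by (simp add: D_def r_def P_def)
    finally have "(\<alpha> (n + 1) + \<alpha> (n - 1)) / 2 < \<alpha> n"
      using e[of n] e[of "n + 1"] e[of "n - 1"] unfolding abs_le_iff by argo
    moreover have "0 \<le> \<alpha> k" for k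
      unfolding \<alpha>_def using c rP by simp
    ultimately have "((\<alpha> (n + 1) + \<alpha> (n - 1)) / 2)\<^sup>2 < (\<alpha> n)\<^sup>2"
      by (intro power_strict_mono) auto
    moreover have "\<alpha> (n + 1) * \<alpha> (n - 1) \<le> ((\<alpha> (n + 1) + \<alpha> (n - 1)) / 2)\<^sup>2"
    proof -
      have "((\<alpha> (n + 1) + \<alpha> (n - 1)) / 2)\<^sup>2 - \<alpha> (n + 1) * \<alpha> (n - 1) = ((\<alpha> (n + 1) - \<alpha> (n - 1)) / 2)\<^sup>2"
        by (simp add: power2_eq_square field_simps)
      then show ?thesis by (metis diff_ge_0_iff_ge zero_le_power2)
    qed
    ultimately have "\<alpha> (n + 1) * \<alpha> (n - 1) < (\<alpha> n)\<^sup>2" by linarith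
    moreover have "\<alpha> (n + 1) * \<alpha> (n - 1) =
        (real_of_int c)\<^sup>2 * r ^ (2 * n) * real (N2bar a c (n - 1) * N2bar a c (n + 1))"
    proof -
      \<comment> \<open>The exponents add up to \<open>2 * n\<close> only for
        \<open>n \<ge> 1\<close>, because of truncated subtraction.\<close>
      have "r ^ (n + 1) * r ^ (n - 1) = r ^ (2 * n)"
        unfolding power_add[symmetric] by (rule arg_cong[where f = "(^) r"]) (use elim(2) in simp)
      then show ?thesis by (simp add: \<alpha>_def power2_eq_square mult_ac)
    qed
    moreover have "(\<alpha> n)\<^sup>2 = (real_of_int c)\<^sup>2 * r ^ (2 * n) * real (N2bar a c n ^ 2)"
      by (simp add: \<alpha>_def power_mult_distrib power_even_eq)
    ultimately have "(real_of_int c)\<^sup>2 * r ^ (2 * n) * real (N2bar a c (n - 1) * N2bar a c (n + 1)) <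
        (real_of_int c)\<^sup>2 * r ^ (2 * n) * real (N2bar a c n ^ 2)" by simp
    then have "real (N2bar a c (n - 1) * N2bar a c (n + 1)) < real (N2bar a c n ^ 2)"
      by (rule mult_left_less_imp_less) (use rP in simp)
    then show ?case by (simp only: of_nat_less_iff)
  qed
qed

text \<open>The quotients of consecutive values decrease, expressed without division because
  \<open>f (n1 - 1)\<close> may be 0. Strictness of the hypothesis makes \<open>f k\<close> positive
  for \<open>k \<ge> N\<close>, so the factor \<open>f m\<close> introduced in the induction step
  can be cancelled.\<close>

lemma log_concave_imp_ratio_decreasing:
  fixes f :: "nat \<Rightarrow> nat"
  assumes conc: "\<And>n. n \<ge> N \<Longrightarrow> f (n - 1) * f (n + 1) < f n ^ 2" and "N \<le> n1" "n1 \<le> n2"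
  shows "f (n1 - 1) * f (n2 + 1) < f n1 * f n2"
  using assms(3)
proof (induction n2 rule: dec_induct)
  case base
  then show ?case using conc[OF assms(2)] by (simp add: power2_eq_square)
next
  case (step m)
  have pos: "f k > 0" if "k \<ge> N" for k
    using conc[OF that] by (cases "f k") auto
  have m: "m \<ge> N" using step assms by simp
  have "f (n1 - 1) * f (Suc m + 1) * f m \<le> f (n1 - 1) * f (m + 1) * f (m + 1)"
    using conc[of "Suc m"] m by (simp add: power2_eq_square mult_ac mult_le_mono2)
  also have "\<dots> < f n1 * f m * f (m + 1)"
    using step.IH pos[of "m + 1"] m by (intro mult_strict_right_mono) auto
  finally have "(f (n1 - 1) * f (Suc m + 1)) * f m < (f n1 * f (Suc m)) * f m"
    by (simp add: mult_ac)
  then show ?case by simp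
qed

theorem theorem1p3:
  fixes a c :: int
  assumes "c \<ge> 2" and "odd c" and "0 \<le> a" and "a < c"
  shows "\<exists>N::nat. \<forall>n1 n2 :: nat. n1 \<ge> N \<longrightarrow> n2 \<ge> N \<longrightarrow> n1 < n2 + 1 \<longrightarrow>
           N2bar a c n1 * N2bar a c n2 > N2bar a c (n1 - 1) * N2bar a c (n2 + 1)"
proof -
  obtain N where "\<And>n. n \<ge> N \<Longrightarrow> N2bar a c (n - 1) * N2bar a c (n + 1) < N2bar a c n ^ 2"
    using eventually_N2bar_log_concave[OF assms(1)] by (auto simp: eventually_sequentially)
  then show ?thesis
    by (intro exI[of _ N] allI impI log_concave_imp_ratio_decreasing) auto
qed

end
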